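(* The two-dimensional order-preserving pattern matching problem, for a text $\mathbf{T}$ of size $n\times n$ and a pattern $\mathbf{P}$ of size $m\times m$, can be solved in $O(n^2m+m^2\log m)$ time; that is, there is an algorithm that reports all positions $(x,y)$ with $1\le x,y\le n-m+1$ such that $\mathbf{T}[x\!:\!x+m-1,\,y\!:\!y+m-1]\approx\mathbf{P}$ within this time bound.
   Context: Entries are integers, any two comparable in constant time. Two-dimensional strings are indexed as $\mathbf{S}[x,y]$ with horizontal coordinate $x$ (increasing left to right) and vertical coordinate $y$ (increasing top to bottom); $\mathbf{S}[x\!:\!x+w-1,\,y\!:\!y+h-1]$ denotes the $w\times h$ substring with top-left corner at $(x,y)$. Two two-dimensional strings $\mathbf{S},\mathbf{T}$ of the same size $w\times h$ are order-isomorphic, written $\mathbf{S}\approx\mathbf{T}$, if $\mathbf{S}[i_x,i_y]\le\mathbf{S}[j_x,j_y]\iff\mathbf{T}[i_x,i_y]\le\mathbf{T}[j_x,j_y]$ for all $1\le i_x,j_x\le w$ and $1\le i_y,j_y\le h$. *)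

theory Defs
  imports Complex_Main
begin

section \<open>Two-dimensional strings and order-isomorphism\<close>

text \<open>Two-dimensional strings are 1-based: \<open>S x y\<close> is the entry in column \<open>x\<close> and row \<open>y\<close>. The
  width and height are always passed separately; values outside that range are irrelevant.\<close>

type_synonym string2d = "nat \<Rightarrow> nat \<Rightarrow> int"

definition order_isomorphic :: "nat \<Rightarrow> nat \<Rightarrow> string2d \<Rightarrow> string2d \<Rightarrow> bool" where
  "order_isomorphic w h S T \<longleftrightarrow>
     (\<forall>ix\<in>{1..w}. \<forall>iy\<in>{1..h}. \<forall>jx\<in>{1..w}. \<forall>jy\<in>{1..h}.
        S ix iy \<le> S jx jy \<longleftrightarrow> T ix iy \<le> T jx jy)"

text \<open>\<open>substring2d S x y\<close> re-indexes \<open>S\<close> so that \<open>(x, y)\<close> becomes \<open>(1, 1)\<close>.\<close>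

definition substring2d :: "string2d \<Rightarrow> nat \<Rightarrow> nat \<Rightarrow> string2d" where
  "substring2d S x y = (\<lambda>i j. S (x + i - 1) (y + j - 1))"

text \<open>The bound \<open>x \<le> n - m + 1\<close> is written without truncated subtraction, so there are no
  occurrences when \<open>m > n\<close>.\<close>

definition occurrences :: "nat \<Rightarrow> nat \<Rightarrow> string2d \<Rightarrow> string2d \<Rightarrow> (nat \<times> nat) set" where
  "occurrences n m T P =
     {(x, y). 1 \<le> x \<and> x + m \<le> n + 1 \<and> 1 \<le> y \<and> y + m \<le> n + 1 \<and>
              order_isomorphic m m (substring2d T x y) P}"


section \<open>A word RAM with comparison access to the entries\<close>

text \<open>
  Algorithms are programs of a small imperative language with finitely many word-sized registers and
  finitely many word-addressed arrays of words, all initially zero. Each elementary operation costs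
  one time unit. Words are natural numbers of size at most \<open>wmax\<close>; a computation that produces a
  larger word is stuck, so that no computing power can be gained from unit-cost operations on large
  numbers.

  The entries of the text and of the pattern are never available as words. The only operation on
  them is the comparison of two entries, at unit cost, given their coordinates. A comparison that
  refers to coordinates outside the text or the pattern is stuck.
\<close>

type_synonym name = string

datatype arith_op = Add | Sub | Mul | Div | Mod

datatype aexp =
    Const nat
  | Var name
  | Load name aexp
  | Op arith_op aexp aexp

datatype entry =
    Text_Entry aexp aexp
  | Pattern_Entry aexp aexp

datatype bexp =
    Less aexp aexp
  | Equal aexp aexp
  | Entry_Le entry entry
  | Not bexp
  | And bexp bexp

datatype com =
    Skip
  | Assign name aexp
  | Store name aexp aexp
  | Report aexp aexp
  | Seq com com
  | If bexp com com
  | While bexp com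

record env =
  wmax :: nat
  text_size :: nat
  pattern_size :: nat
  text_of :: string2d
  pattern_of :: string2d

text \<open>\<open>reported\<close> is the write-only list of reported positions, most recent first.\<close>

record state =
  regs :: "name \<Rightarrow> nat"
  arrays :: "name \<Rightarrow> nat \<Rightarrow> nat"
  reported :: "(nat \<times> nat) list"

fun arith :: "arith_op \<Rightarrow> nat \<Rightarrow> nat \<Rightarrow> nat" where
  "arith Add a b = a + b"
| "arith Sub a b = a - b"
| "arith Mul a b = a * b"
| "arith Div a b = a div b"
| "arith Mod a b = a mod b"

definition word :: "env \<Rightarrow> nat \<Rightarrow> nat option" where
  "word E k = (if k \<le> wmax E then Some k else None)"

text \<open>Evaluation yields \<open>None\<close> exactly when it is stuck.\<close>

fun aval :: "env \<Rightarrow> state \<Rightarrow> aexp \<Rightarrow> nat option" where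
  "aval E s (Const k) = word E k"
| "aval E s (Var x) = Some (regs s x)"
| "aval E s (Load a i) =
     (case aval E s i of None \<Rightarrow> None | Some k \<Rightarrow> Some (arrays s a k))"
| "aval E s (Op f a b) =
     (case aval E s a of None \<Rightarrow> None | Some u \<Rightarrow>
        (case aval E s b of None \<Rightarrow> None | Some v \<Rightarrow> word E (arith f u v)))"

definition lookup :: "nat \<Rightarrow> string2d \<Rightarrow> nat option \<Rightarrow> nat option \<Rightarrow> int option" where
  "lookup k S a b =
     (case (a, b) of
        (Some x, Some y) \<Rightarrow> if x \<in> {1..k} \<and> y \<in> {1..k} then Some (S x y) else None
      | _ \<Rightarrow> None)"

fun entry_val :: "env \<Rightarrow> state \<Rightarrow> entry \<Rightarrow> int option" where
  "entry_val E s (Text_Entry a b) =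
     lookup (text_size E) (text_of E) (aval E s a) (aval E s b)"
| "entry_val E s (Pattern_Entry a b) =
     lookup (pattern_size E) (pattern_of E) (aval E s a) (aval E s b)"

text \<open>Conjunction is short-circuiting.\<close>

fun bval :: "env \<Rightarrow> state \<Rightarrow> bexp \<Rightarrow> bool option" where
  "bval E s (Less a b) =
     (case (aval E s a, aval E s b) of (Some u, Some v) \<Rightarrow> Some (u < v) | _ \<Rightarrow> None)"
| "bval E s (Equal a b) =
     (case (aval E s a, aval E s b) of (Some u, Some v) \<Rightarrow> Some (u = v) | _ \<Rightarrow> None)"
| "bval E s (Entry_Le e f) =
     (case (entry_val E s e, entry_val E s f) of (Some u, Some v) \<Rightarrow> Some (u \<le> v) | _ \<Rightarrow> None)"
| "bval E s (Not b) = map_option (\<lambda>v. \<not> v) (bval E s b)"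
| "bval E s (And b c) =
     (case bval E s b of None \<Rightarrow> None | Some v \<Rightarrow> if v then bval E s c else Some False)"

text \<open>The cost of an expression is its number of operations. For a conjunction both parts are
  charged, even if the second one is not evaluated.\<close>

fun acost :: "aexp \<Rightarrow> nat" where
  "acost (Const k) = 1"
| "acost (Var x) = 1"
| "acost (Load a i) = 1 + acost i"
| "acost (Op f a b) = 1 + acost a + acost b"

fun entry_cost :: "entry \<Rightarrow> nat" where
  "entry_cost (Text_Entry a b) = acost a + acost b"
| "entry_cost (Pattern_Entry a b) = acost a + acost b"

fun bcost :: "bexp \<Rightarrow> nat" where
  "bcost (Less a b) = 1 + acost a + acost b"
| "bcost (Equal a b) = 1 + acost a + acost b"
| "bcost (Entry_Le e f) = 1 + entry_cost e + entry_cost f"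
| "bcost (Not b) = 1 + bcost b"
| "bcost (And b c) = 1 + bcost b + bcost c"

text \<open>\<open>exec E c s t s'\<close>: started in \<open>s\<close>, the program \<open>c\<close> halts in \<open>s'\<close> after exactly \<open>t\<close> time units.
  There is no such derivation if \<open>c\<close> diverges or gets stuck.\<close>

inductive exec :: "env \<Rightarrow> com \<Rightarrow> state \<Rightarrow> nat \<Rightarrow> state \<Rightarrow> bool" for E :: env where
  Skip: "exec E Skip s 1 s"
| Assign: "aval E s a = Some v \<Longrightarrow>
     exec E (Assign x a) s (1 + acost a) (s\<lparr>regs := (regs s)(x := v)\<rparr>)"
| Store: "aval E s i = Some k \<Longrightarrow> aval E s a = Some v \<Longrightarrow>
     exec E (Store x i a) s (1 + acost i + acost a)
       (s\<lparr>arrays := (arrays s)(x := (arrays s x)(k := v))\<rparr>)"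
| Report: "aval E s a = Some u \<Longrightarrow> aval E s b = Some v \<Longrightarrow>
     exec E (Report a b) s (1 + acost a + acost b) (s\<lparr>reported := (u, v) # reported s\<rparr>)"
| Seq: "exec E c1 s t1 s1 \<Longrightarrow> exec E c2 s1 t2 s2 \<Longrightarrow> exec E (Seq c1 c2) s (t1 + t2) s2"
| IfTrue: "bval E s b = Some True \<Longrightarrow> exec E c1 s t s' \<Longrightarrow>
     exec E (If b c1 c2) s (1 + bcost b + t) s'"
| IfFalse: "bval E s b = Some False \<Longrightarrow> exec E c2 s t s' \<Longrightarrow>
     exec E (If b c1 c2) s (1 + bcost b + t) s'"
| WhileFalse: "bval E s b = Some False \<Longrightarrow> exec E (While b c) s (1 + bcost b) s"
| WhileTrue: "bval E s b = Some True \<Longrightarrow> exec E c s t1 s1 \<Longrightarrow> exec E (While b c) s1 t2 s2 \<Longrightarrow>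
     exec E (While b c) s (1 + bcost b + t1 + t2) s2"

text \<open>Execution is deterministic, so the existence of a halting run with some property says that
  \<^emph>\<open>the\<close> run of the program has it.\<close>

inductive_cases Skip_elim: "exec E Skip s t s'"
inductive_cases Assign_elim: "exec E (Assign x a) s t s'"
inductive_cases Store_elim: "exec E (Store x i a) s t s'"
inductive_cases Report_elim: "exec E (Report a b) s t s'"
inductive_cases Seq_elim: "exec E (Seq c1 c2) s t s'"
inductive_cases If_elim: "exec E (If b c1 c2) s t s'"
inductive_cases While_elim: "exec E (While b c) s t s'"

lemma exec_deterministic:
  "exec E c s t s' \<Longrightarrow> exec E c s u s'' \<Longrightarrow> u = t \<and> s'' = s'"
proof (induction arbitrary: u s'' rule: exec.induct)
  case (Skip s)
  then show ?case by (auto elim: Skip_elim)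
next
  case (Assign s a v x)
  then show ?case by (auto elim: Assign_elim)
next
  case (Store s i k a v x)
  then show ?case by (auto elim: Store_elim)
next
  case (Report s a u b v)
  then show ?case by (auto elim: Report_elim)
next
  case (Seq c1 s t1 s1 c2 t2 s2)
  from Seq.prems obtain r1 q1 r2 where
    q: "exec E c1 s r1 q1" "exec E c2 q1 r2 s''" "u = r1 + r2"
    by (rule Seq_elim)
  from Seq.IH(1)[OF q(1)] have "r1 = t1" "q1 = s1" by simp_all
  with Seq.IH(2)[of r2 s''] q show ?case by simp
next
  case (IfTrue s b c1 t s' c2)
  from IfTrue.prems obtain r where "exec E c1 s r s''" "u = 1 + bcost b + r"
    by (rule If_elim) (simp_all add: IfTrue.hyps)
  with IfTrue.IH[of r s''] show ?case by simp
next
  case (IfFalse s b c2 t s' c1)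
  from IfFalse.prems obtain r where "exec E c2 s r s''" "u = 1 + bcost b + r"
    by (rule If_elim) (simp_all add: IfFalse.hyps)
  with IfFalse.IH[of r s''] show ?case by simp
next
  case (WhileFalse s b c)
  from WhileFalse.prems show ?case
    by (rule While_elim) (simp_all add: WhileFalse.hyps)
next
  case (WhileTrue s b c t1 s1 t2 s2)
  from WhileTrue.prems obtain r1 q1 r2 where
    q: "exec E c s r1 q1" "exec E (While b c) q1 r2 s''" "u = 1 + bcost b + r1 + r2"
    by (rule While_elim) (simp_all add: WhileTrue.hyps)
  from WhileTrue.IH(1)[OF q(1)] have "r1 = t1" "q1 = s1" by simp_all
  with WhileTrue.IH(2)[of r2 s''] q show ?case by simp
qed

definition initial_state :: "nat \<Rightarrow> nat \<Rightarrow> state" where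
  "initial_state n m =
     \<lparr>regs = (\<lambda>_. 0)(''n'' := n, ''m'' := m), arrays = (\<lambda>_ _. 0), reported = []\<rparr>"

text \<open>The word size is \<open>d * log (n + m)\<close> bits, that is, logarithmic in the input size.\<close>

definition machine :: "nat \<Rightarrow> nat \<Rightarrow> nat \<Rightarrow> string2d \<Rightarrow> string2d \<Rightarrow> env" where
  "machine d n m T P =
     \<lparr>wmax = (n + m) ^ d, text_size = n, pattern_size = m, text_of = T, pattern_of = P\<rparr>"

end

theory Submission
  imports Defs
begin

text \<open>
  If \<open>m > n\<close> there is nothing to report; otherwise \<open>m\<^sup>3 \<le> n\<^sup>2 m\<close>, so cubic preprocessing of the
  pattern is affordable. Read pattern and windows column by column as strings of length \<open>m\<^sup>2\<close>. For
  every pattern position \<open>i\<close>, precompute the positions of its predecessor and successor in value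
  among the earlier positions: a match of the first \<open>i\<close> positions extends to \<open>i\<close> iff the comparisons
  with these two come out as in the pattern. They are found by sorting each column by brute force
  and merging every pair of sorted columns, in \<open>O(m\<^sup>3)\<close> time. Each of the at most \<open>n\<close> strips of
  height \<open>m\<close> of the text is then scanned in \<open>O(n m)\<close> time as in the Knuth-Morris-Pratt algorithm,
  where the pattern moves by whole columns and the admissible shifts come from the longest match of
  the pattern with itself shifted by \<open>h\<close> columns, computed naively for every \<open>h\<close>.
\<close>

section \<open>Program logic\<close>

text \<open>Order-isomorphism is an equivalence relation that passes to prefixes and shifted
  factors, and the Knuth-Morris-Pratt argument uses nothing else. But only shifts by whole columns
  turn a window of a strip into another window. Hence just \<open>m\<close> shifts matter, and
  instead of a failure table for all \<open>m * m\<close> prefix lengths it suffices to keep one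
  overlap per shift and to find the smallest admissible shift by trial. The columns skipped pay for
  the trials. In the preprocessing, comparing all pairs of positions would take \<open>m^4\<close>
  steps. Merging two sorted columns with two pointers takes only \<open>O(m)\<close>, and there are
  fewer than \<open>m^2\<close> pairs of columns. Values may coincide, so each neighbour is compared
  in both directions.\<close>

definition run :: "env \<Rightarrow> com \<Rightarrow> state \<Rightarrow> (nat \<Rightarrow> state \<Rightarrow> bool) \<Rightarrow> bool" where
  "run E c s Q \<longleftrightarrow> (\<exists>t s'. exec E c s t s' \<and> Q t s')"

lemma run_mono:
  "run E c s Q \<Longrightarrow> (\<And>t s'. Q t s' \<Longrightarrow> R t s') \<Longrightarrow> run E c s R"
  by (auto simp: run_def)

inductive_simps exec_simps:
  "exec E Skip s t s'"
  "exec E (Assign x a) s t s'"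
  "exec E (Store x i a) s t s'"
  "exec E (Report a b) s t s'"
  "exec E (Seq c1 c2) s t s'"
  "exec E (If b c1 c2) s t s'"

text \<open>These equations make \<open>run\<close> a weakest-precondition transformer whose
  postcondition also receives the elapsed time. As simp rules they execute straight-line code
  symbolically and add up its cost.\<close>

lemma run_Skip [simp]: "run E Skip s Q \<longleftrightarrow> Q 1 s"
  by (simp add: run_def exec_simps)

lemma run_Assign [simp]:
  "run E (Assign x a) s Q \<longleftrightarrow>
     (case aval E s a of None \<Rightarrow> False
      | Some v \<Rightarrow> Q (1 + acost a) (s\<lparr>regs := (regs s)(x := v)\<rparr>))"
  by (auto simp: run_def exec_simps split: option.split)

lemma run_Store [simp]:
  "run E (Store x i a) s Q \<longleftrightarrow>
     (case aval E s i of None \<Rightarrow> False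
      | Some k \<Rightarrow> case aval E s a of None \<Rightarrow> False
      | Some v \<Rightarrow> Q (1 + acost i + acost a)
          (s\<lparr>arrays := (arrays s)(x := (arrays s x)(k := v))\<rparr>))"
  by (auto simp: run_def exec_simps split: option.split)

lemma run_Report [simp]:
  "run E (Report a b) s Q \<longleftrightarrow>
     (case aval E s a of None \<Rightarrow> False
      | Some u \<Rightarrow> case aval E s b of None \<Rightarrow> False
      | Some v \<Rightarrow> Q (1 + acost a + acost b) (s\<lparr>reported := (u, v) # reported s\<rparr>))"
  by (auto simp: run_def exec_simps split: option.split)

lemma run_Seq [simp]:
  "run E (Seq c1 c2) s Q \<longleftrightarrow> run E c1 s (\<lambda>t1 s1. run E c2 s1 (\<lambda>t2. Q (t1 + t2)))"
  unfolding run_def exec_simps by blast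

lemma run_If [simp]:
  "run E (If b c1 c2) s Q \<longleftrightarrow>
     (case bval E s b of None \<Rightarrow> False
      | Some v \<Rightarrow> run E (if v then c1 else c2) s (\<lambda>t. Q (1 + bcost b + t)))"
proof (cases "bval E s b")
  case (Some v)
  then show ?thesis by (cases v) (simp_all add: run_def exec_simps, blast+)
qed (simp add: run_def exec_simps)

text \<open>The measure \<open>\<mu>\<close> is a potential: it pays for the cost of every iteration.\<close>

lemma run_While:
  assumes "I s"
    and step: "\<And>s. I s \<Longrightarrow> case bval E s b of None \<Rightarrow> False
      | Some v \<Rightarrow> (v \<longrightarrow> run E c s (\<lambda>t s'. I s' \<and> t + 1 + bcost b + \<mu> s' \<le> \<mu> s))"
  shows "run E (While b c) s
    (\<lambda>t s'. I s' \<and> bval E s' b = Some False \<and> t \<le> \<mu> s + 1 + bcost b)"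
  using assms(1)
proof (induction "\<mu> s" arbitrary: s rule: less_induct)
  case less
  obtain v where v: "bval E s b = Some v"
    and c: "v \<Longrightarrow> run E c s (\<lambda>t s'. I s' \<and> t + 1 + bcost b + \<mu> s' \<le> \<mu> s)"
    using step[OF less.prems] by (auto split: option.splits)
  show ?case
  proof (cases v)
    case True
    then obtain t1 s1 where 1: "exec E c s t1 s1" "I s1" "t1 + 1 + bcost b + \<mu> s1 \<le> \<mu> s"
      using c by (auto simp: run_def)
    then have "run E (While b c) s1
        (\<lambda>t s'. I s' \<and> bval E s' b = Some False \<and> t \<le> \<mu> s1 + 1 + bcost b)"
      by (intro less.hyps) auto
    then obtain t2 s2 where 2: "exec E (While b c) s1 t2 s2" "I s2" "bval E s2 b = Some False"
      "t2 \<le> \<mu> s1 + 1 + bcost b"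
      by (auto simp: run_def)
    have "exec E (While b c) s (1 + bcost b + t1 + t2) s2"
      using v True 1(1) 2(1) by (intro exec.WhileTrue) auto
    moreover have "1 + bcost b + t1 + t2 \<le> \<mu> s + 1 + bcost b"
      using 1 2 by linarith
    ultimately show ?thesis using 2 unfolding run_def by blast
  next
    case False
    then have "exec E (While b c) s (1 + bcost b) s" using v by (intro exec.WhileFalse) auto
    moreover have "1 + bcost b \<le> \<mu> s + 1 + bcost b" by simp
    moreover have "bval E s b = Some False" using v False by simp
    ultimately show ?thesis using less.prems unfolding run_def by blast
  qed
qed

text \<open>If every iteration costs at most \<open>K\<close> and the count \<open>f\<close> drops,
  \<open>f * K\<close> is a potential. This covers every loop except the strip scan, whose
  iterations differ in cost.\<close>

lemma run_While_count:
  assumes "I s"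
    and "\<And>s. I s \<Longrightarrow> case bval E s b of None \<Rightarrow> False
      | Some v \<Rightarrow> (v \<longrightarrow> run E c s (\<lambda>t s'. I s' \<and> t + 1 + bcost b \<le> K \<and> f s' < f s))"
  shows "run E (While b c) s
    (\<lambda>t s'. I s' \<and> bval E s' b = Some False \<and> t \<le> f s * K + 1 + bcost b)"
proof (rule run_While[where \<mu> = "\<lambda>s. f s * K"])
  fix s assume "I s"
  have *: "t + 1 + bcost b + f s' * K \<le> f s * K" if "t + 1 + bcost b \<le> K" "f s' < f s" for t s'
  proof -
    have "Suc (f s') * K \<le> f s * K" using that(2) by (intro mult_right_mono) auto
    then show ?thesis using that(1) by simp
  qed
  obtain v where v: "bval E s b = Some v"
      "v \<Longrightarrow> run E c s (\<lambda>t s'. I s' \<and> t + 1 + bcost b \<le> K \<and> f s' < f s)"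
    using assms(2)[OF \<open>I s\<close>] by (auto split: option.splits)
  have "run E c s (\<lambda>t s'. I s' \<and> t + 1 + bcost b + f s' * K \<le> f s * K)" if v
    using v(2)[OF that] by (rule run_mono) (use * in blast)
  with v(1) show "case bval E s b of None \<Rightarrow> False
      | Some v \<Rightarrow> (v \<longrightarrow> run E c s (\<lambda>t s'. I s' \<and> t + 1 + bcost b + f s' * K \<le> f s * K))"
    by simp
qed (fact assms(1))

section \<open>Frame conditions\<close>

definition agree_off :: "'a set \<Rightarrow> ('a \<Rightarrow> 'b) \<Rightarrow> ('a \<Rightarrow> 'b) \<Rightarrow> bool" where
  "agree_off X f g \<longleftrightarrow> (\<forall>x. x \<notin> X \<longrightarrow> g x = f x)"

lemma agree_off_refl [simp]: "agree_off X f f"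
  by (simp add: agree_off_def)

text \<open>Peels off permitted updates one at a time, so that the simplifier settles frame
  conditions after symbolic execution.\<close>

lemma agree_off_update [simp]: "x \<in> X \<Longrightarrow> agree_off X f (g(x := v)) \<longleftrightarrow> agree_off X f g"
  by (auto simp: agree_off_def)

definition frame :: "name set \<Rightarrow> name set \<Rightarrow> state \<Rightarrow> state \<Rightarrow> bool" where
  "frame X A s s' \<longleftrightarrow> agree_off X (regs s) (regs s') \<and> agree_off A (arrays s) (arrays s') \<and>
     reported s' = reported s"

lemma frameD:
  assumes "frame X A s s'"
  shows "x \<notin> X \<Longrightarrow> regs s' x = regs s x" "a \<notin> A \<Longrightarrow> arrays s' a = arrays s a"
    "reported s' = reported s"
  using assms by (auto simp: frame_def agree_off_def)

section \<open>Order-isomorphism of linear strings\<close>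

definition order_match :: "nat \<Rightarrow> (nat \<Rightarrow> int) \<Rightarrow> (nat \<Rightarrow> int) \<Rightarrow> bool" where
  "order_match q f g \<longleftrightarrow> (\<forall>i<q. \<forall>j<q. f i \<le> f j \<longleftrightarrow> g i \<le> g j)"

lemma order_match_0 [simp]: "order_match 0 f g"
  by (simp add: order_match_def)

lemma order_match_sym: "order_match q f g \<Longrightarrow> order_match q g f"
  by (simp add: order_match_def)

lemma order_match_trans: "order_match q f g \<Longrightarrow> order_match q g h \<Longrightarrow> order_match q f h"
  by (simp add: order_match_def)

lemma order_match_shift:
  "order_match q f g \<Longrightarrow> k + r \<le> q \<Longrightarrow> order_match r (\<lambda>i. f (k + i)) (\<lambda>i. g (k + i))"
  by (simp add: order_match_def)

lemma order_match_mono: "order_match r f g \<Longrightarrow> q \<le> r \<Longrightarrow> order_match q f g"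
  by (auto simp: order_match_def)

section \<open>Predecessors and successors in value\<close>

definition best :: "(nat \<Rightarrow> nat \<Rightarrow> bool) \<Rightarrow> nat \<Rightarrow> nat set \<Rightarrow> nat \<Rightarrow> bool" where
  "best R i A v \<longleftrightarrow> (if A = {} then v = i else v \<in> A \<and> (\<forall>j\<in>A. R j v))"

lemma bestD: "best R i A v \<Longrightarrow> j \<in> A \<Longrightarrow> v \<in> A \<and> R j v"
  by (auto simp: best_def split: if_splits)

definition improve :: "(nat \<Rightarrow> nat \<Rightarrow> bool) \<Rightarrow> nat \<Rightarrow> nat \<Rightarrow> nat \<Rightarrow> nat" where
  "improve R i v w = (if v = i \<or> R v w then w else v)"

text \<open>\<open>R\<close> is a total preorder, so the better of the two optima is optimal for the
  union. Since \<open>i\<close> is outside \<open>A\<close>, the test \<open>v = i\<close> in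
  \<open>improve\<close> recognises an empty \<open>A\<close>.\<close>

lemma best_improve:
  assumes "best R i A v" "i \<notin> A" "B \<noteq> {}" "best R i B w"
    and "\<And>a b. R a b \<or> R b a" "\<And>a b c. R a b \<Longrightarrow> R b c \<Longrightarrow> R a c"
  shows "best R i (A \<union> B) (improve R i v w)"
proof (cases "A = {}")
  case True
  then show ?thesis using assms(1,3,4) by (auto simp: best_def improve_def)
next
  case False
  then have A: "v \<in> A" "v \<noteq> i" "\<forall>j\<in>A. R j v" and B: "w \<in> B" "\<forall>j\<in>B. R j w"
    using assms(1-4) by (auto simp: best_def)
  show ?thesis
  proof (cases "R v w")
    case True
    then have "\<forall>j\<in>A \<union> B. R j w" using A B assms(6) by blast
    then show ?thesis using True B by (auto simp: best_def improve_def)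
  next
    case False
    then have "R w v" using assms(5) by blast
    then have "\<forall>j\<in>A \<union> B. R j v" using A B assms(6) by blast
    then show ?thesis using False A by (auto simp: best_def improve_def)
  qed
qed

text \<open>\<open>u\<close> and \<open>v\<close> are the predecessor and the successor of \<open>i\<close> in value among the members of \<open>A\<close>
  below \<open>i\<close>. The value \<open>i\<close> itself stands for a missing one, so that comparing \<open>i\<close> with it is vacuous.\<close>

definition neighbours ::
  "(nat \<Rightarrow> int) \<Rightarrow> nat set \<Rightarrow> nat \<Rightarrow> nat \<Rightarrow> nat \<Rightarrow> bool" where
  "neighbours p A i u v \<longleftrightarrow>
     best (\<lambda>a b. p a \<le> p b) i {j \<in> A. j < i \<and> p j \<le> p i} u \<and>
     best (\<lambda>a b. p b \<le> p a) i {j \<in> A. j < i \<and> p i < p j} v"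

lemma neighbours_le: "neighbours p A i u v \<Longrightarrow> u \<le> i \<and> v \<le> i"
  by (auto simp: neighbours_def best_def split: if_splits)

lemma neighbours_cong:
  "(\<And>j. j < i \<Longrightarrow> j \<in> A \<longleftrightarrow> j \<in> B) \<Longrightarrow> neighbours p A i u v \<longleftrightarrow> neighbours p B i u v"
proof -
  assume "\<And>j. j < i \<Longrightarrow> j \<in> A \<longleftrightarrow> j \<in> B"
  then have "{j \<in> A. j < i \<and> Q j} = {j \<in> B. j < i \<and> Q j}" for Q by auto
  then show ?thesis by (simp add: neighbours_def)
qed

lemma neighbours_empty: "neighbours p {} i i i"
  by (simp add: neighbours_def best_def)

text \<open>The sorted list splits at \<open>t\<close> into values at most \<open>p i\<close> and
  larger ones, so only the two elements next to the cut can beat the current neighbours.\<close>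

lemma neighbours_merge:
  fixes f :: "nat \<Rightarrow> nat"
  assumes A: "neighbours p A i u v"
    and f: "\<And>k l. k \<le> l \<Longrightarrow> l < m \<Longrightarrow> p (f k) \<le> p (f l)"
    and less: "\<And>k. k < m \<Longrightarrow> f k < i"
    and t: "t \<le> m" "\<And>k. k < m \<Longrightarrow> p (f k) \<le> p i \<longleftrightarrow> k < t"
  shows "neighbours p (A \<union> f ` {..<m}) i
    (if 0 < t then improve (\<lambda>a b. p a \<le> p b) i u (f (t - 1)) else u)
    (if t < m then improve (\<lambda>a b. p b \<le> p a) i v (f t) else v)"
proof -
  have "k < m" if "k < t" for k using that t(1) by simp
  note below = this less[OF this] t(2)[OF this]
  have above: "p i < p (f k) \<longleftrightarrow> t \<le> k" if "k < m" for k using t(2)[OF that] by auto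
  have 1: "{j \<in> A \<union> f ` {..<m}. j < i \<and> p j \<le> p i} =
      {j \<in> A. j < i \<and> p j \<le> p i} \<union> f ` {..<t}"
    by (auto simp: t(2) below)
  have 2: "{j \<in> A \<union> f ` {..<m}. j < i \<and> p i < p j} =
      {j \<in> A. j < i \<and> p i < p j} \<union> f ` {t..<m}"
    by (auto simp: above less)
  have "best (\<lambda>a b. p a \<le> p b) i ({j \<in> A. j < i \<and> p j \<le> p i} \<union> f ` {..<t})
      (improve (\<lambda>a b. p a \<le> p b) i u (f (t - 1)))" if "0 < t"
  proof (rule best_improve)
    show "best (\<lambda>a b. p a \<le> p b) i (f ` {..<t}) (f (t - 1))"
      using that t(1) by (auto simp: best_def intro!: f)
  qed (use A that in \<open>auto simp: neighbours_def\<close>)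
  moreover have "best (\<lambda>a b. p b \<le> p a) i ({j \<in> A. j < i \<and> p i < p j} \<union> f ` {t..<m})
      (improve (\<lambda>a b. p b \<le> p a) i v (f t))" if "t < m"
  proof (rule best_improve)
    show "best (\<lambda>a b. p b \<le> p a) i (f ` {t..<m}) (f t)"
      using that by (auto simp: best_def intro!: f)
  qed (use A that in \<open>auto simp: neighbours_def\<close>)
  ultimately show ?thesis
    using A t(1) unfolding neighbours_def 1 2 by auto
qed

lemma neighbours_insert:
  assumes "neighbours p A i u v"
  shows "neighbours p (insert j A) i
    (if j < i \<and> p j \<le> p i then improve (\<lambda>a b. p a \<le> p b) i u j else u)
    (if j < i \<and> p i < p j then improve (\<lambda>a b. p b \<le> p a) i v j else v)"
proof (cases "j < i")
  case True
  let ?t = "if p j \<le> p i then 1 else 0 :: nat"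
  have "neighbours p (A \<union> (\<lambda>_. j) ` {..<1::nat}) i
      (if 0 < ?t then improve (\<lambda>a b. p a \<le> p b) i u ((\<lambda>_. j) (?t - 1)) else u)
      (if ?t < 1 then improve (\<lambda>a b. p b \<le> p a) i v ((\<lambda>_. j) ?t) else v)"
    by (rule neighbours_merge[OF assms]) (use True in auto)
  moreover have "A \<union> (\<lambda>_. j) ` {..<1::nat} = insert j A" by auto
  ultimately show ?thesis using True by (cases "p j \<le> p i") simp_all
next
  case False
  then have "neighbours p (insert j A) i u v \<longleftrightarrow> neighbours p A i u v"
    by (intro neighbours_cong) auto
  with assms False show ?thesis by simp
qed

text \<open>Sandwich argument: if \<open>g j \<le> g q\<close>, then
  \<open>g j \<le> g u \<le> g q\<close>; the match below \<open>q\<close> carries the first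
  inequality over to \<open>f\<close>, and the tests carry the second. Larger values go through
  \<open>v\<close>. Testing both directions settles ties.\<close>

lemma order_match_Suc:
  assumes "order_match q f g" and uv: "neighbours g {..<q} q u v"
    and "f q \<le> f u \<longleftrightarrow> g q \<le> g u" "f u \<le> f q \<longleftrightarrow> g u \<le> g q"
    and "f q \<le> f v \<longleftrightarrow> g q \<le> g v" "f v \<le> f q \<longleftrightarrow> g v \<le> g q"
  shows "order_match (Suc q) f g"
proof -
  have m: "f i \<le> f j \<longleftrightarrow> g i \<le> g j" if "i < q" "j < q" for i j
    using assms(1) that by (simp add: order_match_def)
  have *: "(f q \<le> f j \<longleftrightarrow> g q \<le> g j) \<and> (f j \<le> f q \<longleftrightarrow> g j \<le> g q)" if j: "j < q" for j
  proof (cases "g j \<le> g q")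
    case True
    then have u: "u < q" "g u \<le> g q" "g j \<le> g u"
      using bestD[of "\<lambda>a b. g a \<le> g b" q "{j \<in> {..<q}. j < q \<and> g j \<le> g q}" u j] uv j
      by (simp_all add: neighbours_def)
    with m[of j u] m[of u j] j assms(3,4) True show ?thesis by linarith
  next
    case False
    then have v: "v < q" "g q < g v" "g v \<le> g j"
      using bestD[of "\<lambda>a b. g b \<le> g a" q "{j \<in> {..<q}. j < q \<and> g q < g j}" v j] uv j
      by (simp_all add: neighbours_def)
    with m[of j v] m[of v j] j assms(5,6) False show ?thesis by linarith
  qed
  then show ?thesis using m by (auto simp: order_match_def less_Suc_eq)
qed

text \<open>The converse holds because \<open>u\<close> and \<open>v\<close> are at most
  \<open>q\<close>, which makes the four tests instances of the longer match. So constantly many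
  comparisons decide an extension.\<close>

lemma order_match_Suc_iff:
  assumes "order_match q f g" "neighbours g {..<q} q u v"
  shows "order_match (Suc q) f g \<longleftrightarrow>
    (f q \<le> f u \<longleftrightarrow> g q \<le> g u) \<and> (f u \<le> f q \<longleftrightarrow> g u \<le> g q) \<and>
    (f q \<le> f v \<longleftrightarrow> g q \<le> g v) \<and> (f v \<le> f q \<longleftrightarrow> g v \<le> g q)"
  using order_match_Suc[OF assms] neighbours_le[OF assms(2)]
  by (auto simp: order_match_def less_Suc_eq_le)

text \<open>Ties are broken by index, so that ranks within a column are distinct.\<close>

definition before :: "(nat \<Rightarrow> int) \<Rightarrow> nat \<Rightarrow> nat \<Rightarrow> bool" where
  "before p j i \<longleftrightarrow> (if j < i then p j \<le> p i else p j < p i)"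

definition rank :: "(nat \<Rightarrow> int) \<Rightarrow> nat \<Rightarrow> nat \<Rightarrow> nat" where
  "rank p m i = card {j. i div m * m \<le> j \<and> j < i div m * m + m \<and> before p j i}"

lemma column_iff: "0 < m \<Longrightarrow> c * m \<le> j \<and> j < c * m + m \<longleftrightarrow> j div m = (c::nat)"
  by (auto simp: mult.commute div_nat_eqI dividend_less_times_div add.commute)

text \<open>The place of \<open>i\<close> once each column is sorted within its own block of
  \<open>m\<close> cells.\<close>

definition slot :: "(nat \<Rightarrow> int) \<Rightarrow> nat \<Rightarrow> nat \<Rightarrow> nat" where
  "slot p m i = i div m * m + rank p m i"

lemma before_trans: "before p a b \<Longrightarrow> before p b c \<Longrightarrow> before p a c"
  by (auto simp: before_def split: if_splits)

lemma before_total: "a \<noteq> b \<Longrightarrow> before p a b \<or> before p b a"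
  by (auto simp: before_def)

lemma before_irrefl: "\<not> before p a a"
  by (auto simp: before_def)

text \<open>By transitivity everything before \<open>j\<close> is before \<open>i\<close>, and
  \<open>j\<close> itself is counted only for \<open>i\<close>.\<close>

lemma rank_mono:
  assumes "before p j i" "j div m = i div m" "0 < m"
  shows "rank p m j < rank p m i"
proof -
  have "{k. j div m * m \<le> k \<and> k < j div m * m + m \<and> before p k j} \<subset>
        {k. i div m * m \<le> k \<and> k < i div m * m + m \<and> before p k i}"
    (is "?A \<subset> ?B")
  proof -
    have "j \<in> ?B" "j \<notin> ?A"
      using assms column_iff[of m "i div m" j] before_irrefl[of p j] by simp_all
    moreover have "?A \<subseteq> ?B" using assms by (auto intro: before_trans)
    ultimately show ?thesis by blast
  qed
  then show ?thesis unfolding rank_def by (intro psubset_card_mono) auto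
qed

lemma rank_less: "0 < m \<Longrightarrow> rank p m i < m"
proof -
  assume m: "0 < m"
  have "{j. i div m * m \<le> j \<and> j < i div m * m + m \<and> before p j i} \<subset> {i div m * m ..< i div m * m + m}"
    (is "?A \<subset> ?B")
  proof -
    have "i \<in> ?B" "i \<notin> ?A" using before_irrefl[of p i] column_iff[OF m, of "i div m" i] by simp_all
    moreover have "?A \<subseteq> ?B" by auto
    ultimately show ?thesis by blast
  qed
  then have "rank p m i < card {i div m * m ..< i div m * m + m}"
    unfolding rank_def by (intro psubset_card_mono) auto
  then show ?thesis by simp
qed

lemma slot_div: "0 < m \<Longrightarrow> slot p m i div m = i div m"
  using rank_less[of m p i] by (simp add: slot_def)

lemma slot_inject: "0 < m \<Longrightarrow> slot p m i = slot p m j \<longleftrightarrow> i = j"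
proof
  assume m: "0 < m" and "slot p m i = slot p m j"
  then have "i div m = j div m" "rank p m i = rank p m j"
    using slot_div[OF m, of p i] slot_div[OF m, of p j] by (simp_all add: slot_def)
  then show "i = j" using rank_mono[OF _ _ m, of p i j] rank_mono[OF _ _ m, of p j i] before_total[of i j p]
    by fastforce
qed auto

lemma slot_less: "0 < m \<Longrightarrow> i < c * m \<Longrightarrow> slot p m i < c * m"
  using slot_div[of m p i] by (simp add: div_less_iff_less_mult[symmetric])

lemma slot_mono:
  assumes "0 < m" "slot p m j \<le> slot p m i" "j div m = i div m"
  shows "p j \<le> p i"
proof -
  have "j = i \<or> before p j i"
    using assms rank_mono[of p i j m] before_total[of i j p] by (auto simp: slot_def)
  then show ?thesis by (auto simp: before_def split: if_splits)
qed

text \<open>An injective map of a finite set into itself is onto. This allows reading the array of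
  sorted positions at an arbitrary cell.\<close>

lemma slot_surj:
  assumes "0 < m" "k < c * m"
  obtains i where "i < c * m" "slot p m i = k"
proof -
  have lt: "i < c * m \<longleftrightarrow> i div m < c" for i
    using assms(1) by (simp add: div_less_iff_less_mult)
  have "slot p m ` {..<c * m} = {..<c * m}"
  proof (rule card_subset_eq)
    show "slot p m ` {..<c * m} \<subseteq> {..<c * m}"
      by (auto simp: lt slot_div[OF assms(1)])
    show "card (slot p m ` {..<c * m}) = card {..<c * m}"
      by (intro card_image inj_onI) (simp add: slot_inject[OF assms(1)])
  qed simp
  then show ?thesis using that assms(2) by (metis imageE lessThan_iff)
qed

section \<open>Sorting the columns of the pattern\<close>

notation Seq (infixr ";;" 60)

abbreviation inc :: "name \<Rightarrow> com" where
  "inc x \<equiv> Assign x (Op Add (Var x) (Const 1))"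

text \<open>Pattern positions are linear indices \<open>i < m * m\<close>: column \<open>i div m\<close> and row \<open>i mod m\<close>, 0-based.
  Register \<open>N\<close> holds \<open>m * m\<close>. Arrays \<open>p\<close> and \<open>s\<close> hold predecessors and successors, \<open>o\<close> the
  positions of each column in sorted order, and \<open>z\<close> the longest self-match for every shift.\<close>

definition cell :: "aexp \<Rightarrow> entry" where
  "cell i = Pattern_Entry (Op Add (Op Div i (Var ''m'')) (Const 1))
                          (Op Add (Op Mod i (Var ''m'')) (Const 1))"

text \<open>De Morgan form of the condition in \<open>improve\<close>. Short-circuiting skips the
  entry comparison if the stored neighbour is the sentinel.\<close>

definition improve_pred :: com where
  "improve_pred =
     If (Not (And (Not (Equal (Load ''p'' (Var ''i'')) (Var ''i'')))
                  (Not (Entry_Le (cell (Load ''p'' (Var ''i''))) (cell (Var ''w''))))))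
       (Store ''p'' (Var ''i'') (Var ''w'')) Skip"

definition improve_succ :: com where
  "improve_succ =
     If (Not (And (Not (Equal (Load ''s'' (Var ''i'')) (Var ''i'')))
                  (Not (Entry_Le (cell (Var ''w'')) (cell (Load ''s'' (Var ''i'')))))))
       (Store ''s'' (Var ''i'') (Var ''w'')) Skip"

text \<open>The counter \<open>r\<close> follows \<open>before\<close>: ties count only from smaller
  indices. For \<open>w = i\<close> the self-comparison succeeds and nothing is counted.\<close>

definition scan_column :: com where
  "scan_column =
     While (Less (Var ''k'') (Var ''m''))
       (If (Less (Var ''w'') (Var ''i''))
          (If (Entry_Le (cell (Var ''w'')) (cell (Var ''i'')))
            (inc ''r'' ;; improve_pred)
            improve_succ)
          (If (Entry_Le (cell (Var ''i'')) (cell (Var ''w''))) Skip (inc ''r'')) ;;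
        inc ''w'' ;;
        inc ''k'')"

definition sort_columns :: com where
  "sort_columns =
     Assign ''i'' (Const 0) ;;
     While (Less (Var ''i'') (Var ''N''))
       (Store ''p'' (Var ''i'') (Var ''i'') ;;
        Store ''s'' (Var ''i'') (Var ''i'') ;;
        Assign ''c'' (Op Sub (Var ''i'') (Op Mod (Var ''i'') (Var ''m''))) ;;
        Assign ''w'' (Var ''c'') ;;
        Assign ''r'' (Const 0) ;;
        Assign ''k'' (Const 0) ;;
        scan_column ;;
        Store ''o'' (Op Add (Var ''c'') (Var ''r'')) (Var ''i'') ;;
        inc ''i'')"

locale matching =
  fixes n m :: nat and T P :: string2d
  assumes m_pos: "0 < m" and m_le_n: "m \<le> n"
begin

text \<open>All words that occur are at most a constant times \<open>n\<^sup>2\<close>; the exponent 4 absorbs the constant.\<close>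

definition E :: env where "E = machine 4 n m T P"

definition p :: "nat \<Rightarrow> int" where "p i = P (i div m + 1) (i mod m + 1)"

lemma bounds: "0 < m" "m \<le> n" "m \<le> m * m" "m * m \<le> n * m" "n * m \<le> n * n" "n \<le> n * m" "0 < n"
  using m_pos m_le_n by auto

text \<open>Squaring \<open>4 * n \<le> (n + m)^2\<close> shows that the fourth power leaves room
  for \<open>16 * n^2\<close>.\<close>

lemma word_Some [simp]: "k \<le> 8 * (n * n) \<Longrightarrow> word E k = Some k"
proof -
  assume k: "k \<le> 8 * (n * n)"
  have "4 * n \<le> (n + m) * (n + m)"
  proof -
    have "4 * n \<le> (n + 1) * (n + 1)" by (cases n) auto
    also have "\<dots> \<le> (n + m) * (n + m)" using m_pos by (intro mult_mono) auto
    finally show ?thesis .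
  qed
  from mult_le_mono[OF this this] have "8 * (n * n) \<le> wmax E"
    by (simp add: E_def machine_def power4_eq_xxxx mult.assoc)
  then show ?thesis using k by (simp add: word_def)
qed

lemma sizes [simp]: "text_size E = n" "pattern_size E = m" "text_of E = T" "pattern_of E = P"
  by (simp_all add: E_def machine_def)

lemma cell_val [simp]:
  assumes "aval E s a = Some i" "i < m * m" "regs s ''m'' = m"
  shows "entry_val E s (cell a) = Some (p i)"
proof -
  have "i div m < m" "i mod m < m"
    using assms(2) m_pos by (auto simp: div_less_iff_less_mult)
  moreover have "word E 1 = Some 1" "word E (i div m) = Some (i div m)"
    "word E (i mod m) = Some (i mod m)" "word E (i div m + 1) = Some (i div m + 1)"
    "word E (i mod m + 1) = Some (i mod m + 1)"
    using bounds calculation by (intro word_Some; linarith)+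
  ultimately show ?thesis
    using assms m_pos by (simp add: cell_def p_def lookup_def Suc_le_eq)
qed

lemma cell_cost [simp]: "entry_cost (cell a) = 8 + 2 * acost a"
  by (simp add: cell_def)

definition base :: "state \<Rightarrow> bool" where
  "base s \<longleftrightarrow> regs s ''n'' = n \<and> regs s ''m'' = m \<and> regs s ''N'' = m * m \<and> reported s = []"

abbreviation le_p :: "nat \<Rightarrow> nat \<Rightarrow> bool" where "le_p a b \<equiv> p a \<le> p b"
abbreviation ge_p :: "nat \<Rightarrow> nat \<Rightarrow> bool" where "ge_p a b \<equiv> p b \<le> p a"

text \<open>The bound on the stored index keeps the comparison inside the pattern. The result is
  phrased with \<open>improve\<close> to fit \<open>neighbours_insert\<close> and
  \<open>neighbours_merge\<close>.\<close>

lemma run_improve_pred: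
  assumes "regs s ''m'' = m" "regs s ''i'' = i" "regs s ''w'' = w"
    "i < m * m" "w < m * m" "arrays s ''p'' i \<le> i"
    and "\<And>t. t \<le> 60 \<Longrightarrow> Q t (s\<lparr>arrays := (arrays s)(''p'' := (arrays s ''p'')
                (i := improve le_p i (arrays s ''p'' i) w))\<rparr>)"
  shows "run E improve_pred s Q"
proof (cases "arrays s ''p'' i = i \<or> le_p (arrays s ''p'' i) w")
  case True
  then have "t \<le> 60 \<Longrightarrow> Q t (s\<lparr>arrays := (arrays s)(''p'' := (arrays s ''p'')(i := w))\<rparr>)" for t
    using assms(7)[of t] by (simp add: improve_def)
  then show ?thesis
    using assms(1-6) True by (auto simp: improve_pred_def)
next
  case False
  then have "t \<le> 60 \<Longrightarrow> Q t s" for t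
    using assms(7)[of t] by (simp add: improve_def)
  then show ?thesis
    using assms(1-6) False by (simp add: improve_pred_def)
qed

lemma run_improve_succ:
  assumes "regs s ''m'' = m" "regs s ''i'' = i" "regs s ''w'' = w"
    "i < m * m" "w < m * m" "arrays s ''s'' i \<le> i"
    and "\<And>t. t \<le> 60 \<Longrightarrow> Q t (s\<lparr>arrays := (arrays s)(''s'' := (arrays s ''s'')
                (i := improve ge_p i (arrays s ''s'' i) w))\<rparr>)"
  shows "run E improve_succ s Q"
proof (cases "arrays s ''s'' i = i \<or> ge_p (arrays s ''s'' i) w")
  case True
  then have "t \<le> 60 \<Longrightarrow> Q t (s\<lparr>arrays := (arrays s)(''s'' := (arrays s ''s'')(i := w))\<rparr>)" for t
    using assms(7)[of t] by (simp add: improve_def)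
  then show ?thesis
    using assms(1-6) True by (auto simp: improve_succ_def)
next
  case False
  then have "t \<le> 60 \<Longrightarrow> Q t s" for t
    using assms(7)[of t] by (simp add: improve_def)
  then show ?thesis
    using assms(1-6) False by (simp add: improve_succ_def)
qed

lemma run_scan_column:
  assumes m: "regs s ''m'' = m" and i: "regs s ''i'' = i" "i < m * m"
    and s: "regs s ''w'' = i div m * m" "regs s ''r'' = 0" "regs s ''k'' = 0"
      "arrays s ''p'' i = i" "arrays s ''s'' i = i"
  shows "run E scan_column s (\<lambda>t s'. t \<le> m * 200 + 10 \<and>
    (\<forall>x\<in>{''n'', ''m'', ''N'', ''i'', ''c''}. regs s' x = regs s x) \<and>
    arrays s' ''o'' = arrays s ''o'' \<and> reported s' = reported s \<and>
    (\<forall>j. j \<noteq> i \<longrightarrow> arrays s' ''p'' j = arrays s ''p'' j \<and> arrays s' ''s'' j = arrays s ''s'' j) \<and>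
    neighbours p {j. j div m = i div m} i (arrays s' ''p'' i) (arrays s' ''s'' i) \<and>
    regs s' ''r'' = rank p m i)"
proof -
  define c where "c = i div m * m"
  have c: "c + k < m * m" if "k < m" for k
  proof -
    have "(i div m + 1) * m \<le> m * m"
      using i(2) by (intro mult_right_mono) (auto simp: div_less_iff_less_mult m_pos Suc_le_eq)
    then show ?thesis using that by (simp add: c_def)
  qed
  define I where "I s' \<longleftrightarrow> regs s' ''k'' \<le> m \<and> regs s' ''w'' = c + regs s' ''k'' \<and>
    frame {''k'', ''w'', ''r''} {''p'', ''s''} s s' \<and>
    (\<forall>j. j \<noteq> i \<longrightarrow> arrays s' ''p'' j = arrays s ''p'' j \<and> arrays s' ''s'' j = arrays s ''s'' j) \<and>
    neighbours p {c ..< c + regs s' ''k''} i (arrays s' ''p'' i) (arrays s' ''s'' i) \<and>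
    regs s' ''r'' = card {j \<in> {c ..< c + regs s' ''k''}. before p j i}" for s'
  have "run E scan_column s (\<lambda>t s'. I s' \<and> bval E s' (Less (Var ''k'') (Var ''m'')) = Some False \<and>
    t \<le> (m - regs s ''k'') * 200 + 1 + bcost (Less (Var ''k'') (Var ''m'')))"
    unfolding scan_column_def
  proof (rule run_While_count[where f = "\<lambda>s. m - regs s ''k''"], goal_cases)
    case 1
    show ?case using s by (simp add: I_def c_def neighbours_empty frame_def)
  next
    case (2 s')
    note I = this
    then have fr: "frame {''k'', ''w'', ''r''} {''p'', ''s''} s s'" by (simp add: I_def)
    note f = frameD(1)[OF fr, of "''m''"] frameD(1)[OF fr, of "''i''"]
    define k where "k = regs s' ''k''"
    have regs: "regs s' ''m'' = m" "regs s' ''i'' = i" "regs s' ''k'' = k" "regs s' ''w'' = c + k"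
      using f m i I by (simp_all add: I_def k_def)
    let ?u = "arrays s' ''p'' i" and ?v = "arrays s' ''s'' i"
    have other: "\<forall>j. j \<noteq> i \<longrightarrow>
        arrays s' ''p'' j = arrays s ''p'' j \<and> arrays s' ''s'' j = arrays s ''s'' j"
      using I by (simp add: I_def)
    have nb: "neighbours p {c ..< c + k} i ?u ?v"
      and r: "regs s' ''r'' = card {j \<in> {c ..< c + k}. before p j i}"
      using I by (simp_all add: I_def k_def)
    from neighbours_insert[OF nb, of "c + k"]
    have nb': "neighbours p {c ..< Suc (c + k)} i
       (if c + k < i \<and> p (c + k) \<le> p i then improve le_p i ?u (c + k) else ?u)
       (if c + k < i \<and> p i < p (c + k) then improve ge_p i ?v (c + k) else ?v)"
      by (simp add: atLeastLessThanSuc)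
    have r': "card {j \<in> {c ..< Suc (c + k)}. before p j i} =
      regs s' ''r'' + (if before p (c + k) i then 1 else 0)"
    proof -
      have "{j \<in> {c ..< Suc (c + k)}. before p j i} = {j \<in> {c ..< c + k}. before p j i} \<union>
         (if before p (c + k) i then {c + k} else {})"
        by (auto simp: less_Suc_eq)
      then show ?thesis using r by simp
    qed
    have le: "?u \<le> i" "?v \<le> i" using neighbours_le[OF nb] by auto
    \<comment> \<open>The counter is the size of a subset of an interval of length \<open>k\<close>,
      so its increment fits into a word.\<close>
    have rm: "regs s' ''r'' \<le> k"
      unfolding r by (rule order_trans[OF card_mono[of "{c ..< c + k}"]]) auto
    show ?case
    proof (cases "k < m")
      case False
      then show ?thesis using regs by simp
    next
      case True
      note facts = regs i c[OF True] le rm bounds True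
      have word: "word E 1 = Some 1" "word E (regs s' ''r'' + 1) = Some (regs s' ''r'' + 1)"
        "word E (c + k + 1) = Some (c + k + 1)" "word E (k + 1) = Some (k + 1)"
        using facts by (intro word_Some; linarith)+
      consider "c + k < i" "p (c + k) \<le> p i" | "c + k < i" "\<not> p (c + k) \<le> p i"
        | "\<not> c + k < i" by blast
      then show ?thesis
      proof cases
        case 1
        then have "before p (c + k) i" by (simp add: before_def)
        then show ?thesis
          using facts word fr other nb' r' 1
          apply simp
          apply (rule run_improve_pred[where i=i and w = "c+k"]; simp add: I_def frame_def diff_less_mono2)
          done
      next
        case 2
        then have "\<not> before p (c + k) i" by (simp add: before_def)
        then show ?thesis
          using facts word fr other nb' r' 2
          apply simp
          apply (rule run_improve_succ[where i=i and w = "c+k"]; simp add: I_def frame_def diff_less_mono2)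
          done
      next
        case 3
        then have "before p (c + k) i \<longleftrightarrow> \<not> p i \<le> p (c + k)" by (auto simp: before_def)
        then show ?thesis
          using facts word fr other nb' r' 3
          apply (simp add: I_def frame_def diff_less_mono2)
          done
      qed
    qed
  qed
  then show ?thesis
  proof (rule run_mono, goal_cases)
    case (1 t s')
    then have k: "regs s' ''k'' = m" using m frameD(1)[of _ _ s s' "''m''"] by (auto simp: I_def)
    have "{j. j div m = i div m} = {c ..< c + m}"
      by (simp add: set_eq_iff c_def column_iff[OF m_pos])
    moreover have "rank p m i = card {j \<in> {c ..< c + m}. before p j i}"
      by (simp add: rank_def c_def conj_assoc)
    ultimately show ?case using 1 k s by (simp add: I_def frameD[of "{''k'', ''w'', ''r''}" "{''p'', ''s''}" s s'])
  qed
qed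

text \<open>Storing \<open>o\<close> as an inverse of \<open>slot\<close> records sortedness
  implicitly; \<open>slot_mono\<close> recovers the order of the values.\<close>

definition column_sorted :: "nat \<Rightarrow> state \<Rightarrow> bool" where
  "column_sorted i s \<longleftrightarrow>
     neighbours p {j. j div m = i div m} i (arrays s ''p'' i) (arrays s ''s'' i) \<and>
     arrays s ''o'' (slot p m i) = i"

lemma run_sort_columns:
  assumes "base s"
  shows "run E sort_columns s (\<lambda>t s'. t \<le> m * m * (m * 200 + 100) + 10 \<and> base s' \<and>
    (\<forall>i<m * m. column_sorted i s'))"
proof -
  define I where "I s' \<longleftrightarrow> base s' \<and> regs s' ''i'' \<le> m * m \<and>
    (\<forall>i<regs s' ''i''. column_sorted i s')" for s'
  have I0: "I (s\<lparr>regs := (regs s)(''i'' := 0)\<rparr>)"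
    using assms by (simp add: I_def base_def)
  have "run E (While (Less (Var ''i'') (Var ''N''))
       (Store ''p'' (Var ''i'') (Var ''i'') ;;
        Store ''s'' (Var ''i'') (Var ''i'') ;;
        Assign ''c'' (Op Sub (Var ''i'') (Op Mod (Var ''i'') (Var ''m''))) ;;
        Assign ''w'' (Var ''c'') ;;
        Assign ''r'' (Const 0) ;;
        Assign ''k'' (Const 0) ;;
        scan_column ;;
        Store ''o'' (Op Add (Var ''c'') (Var ''r'')) (Var ''i'') ;;
        inc ''i'')) s1 (\<lambda>t s'. I s' \<and> bval E s' (Less (Var ''i'') (Var ''N'')) = Some False \<and>
    t \<le> (m * m - regs s1 ''i'') * (m * 200 + 100) + 1 + bcost (Less (Var ''i'') (Var ''N'')))"
    if "I s1" for s1
  proof (rule run_While_count[where f = "\<lambda>s. m * m - regs s ''i''"], goal_cases)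
    case 1
    show ?case by (fact that)
  next
    case (2 s')
    define i where "i = regs s' ''i''"
    have regs: "regs s' ''i'' = i" "regs s' ''m'' = m" "regs s' ''n'' = n" "regs s' ''N'' = m * m"
      "reported s' = []"
      using 2 by (simp_all add: I_def base_def i_def)
    have old: "column_sorted j s'" if "j < i" for j using 2 that by (simp add: I_def i_def)
    show ?case
    proof (cases "i < m * m")
      case False
      then show ?thesis using regs by simp
    next
      case True
      have mod: "i - i mod m = i div m * m" by (simp add: minus_mod_eq_div_mult)
      have slot: "slot p m i < m * m" using slot_less[OF m_pos True] .
      have word: "word E 0 = Some 0" "word E 1 = Some 1" "word E (i mod m) = Some (i mod m)"
        "word E (i - i mod m) = Some (i - i mod m)" "word E (i + 1) = Some (i + 1)"
        "word E (slot p m i) = Some (slot p m i)"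
        using True bounds mod_less_eq_dividend[of i m] slot by (intro word_Some; linarith)+
      show ?thesis
        using regs True word
        apply (simp add: mod)
        apply (rule run_mono[OF run_scan_column[where i = i]]; simp?)
        apply (elim conjE)
        using old slot
        apply (simp add: slot_def[symmetric] I_def base_def diff_less_mono2)
        \<comment> \<open>Injectivity of \<open>slot\<close> protects the cells written for earlier
          positions.\<close>
        apply (auto simp: less_Suc_eq column_sorted_def slot_inject[OF m_pos])
        done
    qed
  qed
  from this[OF I0] show ?thesis
    using assms bounds unfolding sort_columns_def
    apply simp
    apply (erule run_mono)
    apply (auto simp: I_def base_def)
    done
qed

end

section \<open>Merging pairs of columns\<close>

text \<open>A merge without output: \<open>t\<close> passes the entries of column \<open>b\<close>
  not exceeding the current entry of column \<open>a\<close>, and where it stops, the entries at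
  \<open>t - 1\<close> and \<open>t\<close> are the candidates. It never moves back, since the next
  entry of column \<open>a\<close> is at least as large.\<close>

definition merge_pair :: com where
  "merge_pair =
     While (Less (Var ''k'') (Var ''m''))
       (Assign ''i'' (Load ''o'' (Op Add (Var ''a'') (Var ''k''))) ;;
        If (And (Less (Var ''t'') (Var ''m''))
                (Entry_Le (cell (Load ''o'' (Op Add (Var ''b'') (Var ''t'')))) (cell (Var ''i''))))
          (inc ''t'')
          (If (Less (Const 0) (Var ''t''))
             (Assign ''w'' (Load ''o'' (Op Sub (Op Add (Var ''b'') (Var ''t'')) (Const 1))) ;;
              improve_pred) Skip ;;
           If (Less (Var ''t'') (Var ''m''))
             (Assign ''w'' (Load ''o'' (Op Add (Var ''b'') (Var ''t''))) ;; improve_succ) Skip ;;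
           inc ''k''))"

text \<open>The counter \<open>e\<close> encodes the pair of columns \<open>e div m\<close> and \<open>e mod m\<close>.\<close>

definition merge_columns :: com where
  "merge_columns =
     Assign ''e'' (Const 0) ;;
     While (Less (Var ''e'') (Var ''N''))
       (If (Less (Op Mod (Var ''e'') (Var ''m'')) (Op Div (Var ''e'') (Var ''m'')))
          (Assign ''a'' (Op Mul (Op Div (Var ''e'') (Var ''m'')) (Var ''m'')) ;;
           Assign ''b'' (Op Mul (Op Mod (Var ''e'') (Var ''m'')) (Var ''m'')) ;;
           Assign ''k'' (Const 0) ;;
           Assign ''t'' (Const 0) ;;
           merge_pair)
          Skip ;;
        inc ''e'')"

context matching
begin

lemma index_less: "c < m \<Longrightarrow> k < m \<Longrightarrow> c * m + k < m * m"
proof -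
  assume "c < m" "k < m"
  then have "(c + 1) * m \<le> m * m" by (intro mult_right_mono) auto
  with \<open>k < m\<close> show ?thesis by simp
qed

text \<open>By \<open>slot_surj\<close> each cell is the slot of a position, which the inverse
  \<open>R\<close> then returns.\<close>

lemma sorted_column:
  assumes "\<forall>i<m * m. R (slot p m i) = i" "c < m" "k < m"
  shows "R (c * m + k) < m * m" "R (c * m + k) div m = c" "slot p m (R (c * m + k)) = c * m + k"
proof -
  obtain i where i: "i < m * m" "slot p m i = c * m + k"
    using slot_surj[OF m_pos index_less[OF assms(2,3)]] .
  then have "R (c * m + k) = i" using assms(1) by metis
  moreover have "i div m = c" using slot_div[OF m_pos, of p i] assms(3) by (simp add: i(2))
  ultimately show "R (c * m + k) < m * m" "R (c * m + k) div m = c"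
    "slot p m (R (c * m + k)) = c * m + k" using i by simp_all
qed

lemma run_merge_pair:
  assumes c: "\<alpha> < m" "\<beta> < \<alpha>" and m: "regs s ''m'' = m"
    and s: "regs s ''a'' = \<alpha> * m" "regs s ''b'' = \<beta> * m" "regs s ''k'' = 0" "regs s ''t'' = 0"
    and sorted: "\<And>i. i < m * m \<Longrightarrow> arrays s ''o'' (slot p m i) = i"
    and nb: "\<And>i. i < m * m \<Longrightarrow> neighbours p (A i) i (arrays s ''p'' i) (arrays s ''s'' i)"
  shows "run E merge_pair s (\<lambda>t s'. t \<le> m * 400 + 10 \<and>
    (\<forall>x\<in>{''n'', ''m'', ''N'', ''e''}. regs s' x = regs s x) \<and>
    arrays s' ''o'' = arrays s ''o'' \<and> reported s' = reported s \<and>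
    (\<forall>i<m * m. neighbours p (if i div m = \<alpha> then A i \<union> {j. j div m = \<beta>} else A i) i
       (arrays s' ''p'' i) (arrays s' ''s'' i)))"
proof -
  define R where "R = arrays s ''o''"
  have sorted': "\<forall>i<m * m. R (slot p m i) = i" using sorted by (simp add: R_def)
  note R = sorted_column[of R, OF sorted']
  have mono: "p (R (c * m + k)) \<le> p (R (c * m + l))" if "c < m" "k \<le> l" "l < m" for c k l
    using that by (intro slot_mono[OF m_pos]) (simp_all add: R)
  have column: "(\<lambda>k. R (\<beta> * m + k)) ` {..<m} = {j. j div m = \<beta>}"
  proof (intro equalityI subsetI)
    fix j assume j: "j \<in> {j. j div m = \<beta>}"
    then have "j < m * m" using c by (auto simp: div_less_iff_less_mult[symmetric] m_pos)
    moreover have "slot p m j = \<beta> * m + rank p m j" using j by (simp add: slot_def)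
    ultimately have "j = R (\<beta> * m + rank p m j)" using sorted' by metis
    then show "j \<in> (\<lambda>k. R (\<beta> * m + k)) ` {..<m}" using rank_less[OF m_pos] by blast
  qed (use c R in auto)
  \<comment> \<open>Partway through, exactly the entries of column \<open>\<alpha>\<close> before
    the pointer \<open>k\<close> in sorted order have seen column \<open>\<beta>\<close>.\<close>
  define B where "B k j = (if j div m = \<alpha> \<and> slot p m j < \<alpha> * m + k then A j \<union> {j. j div m = \<beta>} else A j)"
    for k j
  \<comment> \<open>The last conjunct is guarded because cell \<open>\<alpha> * m + m\<close> no
    longer belongs to column \<open>\<alpha>\<close>.\<close>
  define I where "I s' \<longleftrightarrow> regs s' ''k'' \<le> m \<and> regs s' ''t'' \<le> m \<and>
    frame {''k'', ''t'', ''i'', ''w''} {''p'', ''s''} s s' \<and>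
    (\<forall>i<m * m. neighbours p (B (regs s' ''k'') i) i (arrays s' ''p'' i) (arrays s' ''s'' i)) \<and>
    (regs s' ''k'' < m \<longrightarrow>
      (\<forall>l<regs s' ''t''. p (R (\<beta> * m + l)) \<le> p (R (\<alpha> * m + regs s' ''k''))))" for s'
  have "run E merge_pair s (\<lambda>t s'. I s' \<and> bval E s' (Less (Var ''k'') (Var ''m'')) = Some False \<and>
    t \<le> ((m - regs s ''k'') + (m - regs s ''t'')) * 200 + 1 + bcost (Less (Var ''k'') (Var ''m'')))"
    unfolding merge_pair_def
  \<comment> \<open>Every iteration advances exactly one of the two pointers, so there are at most
    \<open>2 * m\<close> of them.\<close>
  proof (rule run_While_count[where f = "\<lambda>s. (m - regs s ''k'') + (m - regs s ''t'')"], goal_cases)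
    case 1
    have "\<not> slot p m j < \<alpha> * m" if "j div m = \<alpha>" for j
      using that by (auto simp: slot_def)
    then show ?case using s nb by (auto simp: I_def frame_def B_def)
  next
    case (2 s')
    note I = this
    then have fr: "frame {''k'', ''t'', ''i'', ''w''} {''p'', ''s''} s s'" by (simp add: I_def)
    note f = frameD(1)[OF fr, of "''m''"] frameD(1)[OF fr, of "''a''"] frameD(1)[OF fr, of "''b''"]
    define k t where "k = regs s' ''k''" and "t = regs s' ''t''"
    have regs: "regs s' ''m'' = m" "regs s' ''a'' = \<alpha> * m" "regs s' ''b'' = \<beta> * m"
      "regs s' ''k'' = k" "regs s' ''t'' = t" "arrays s' ''o'' = R"
      using f m s frameD(2)[OF fr, of "''o''"] by (simp_all add: k_def t_def R_def)
    show ?case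
    proof (cases "k < m")
      case False
      then show ?thesis using regs by simp
    next
      case True
      define i where "i = R (\<alpha> * m + k)"
      have i: "i < m * m" "i div m = \<alpha>" "slot p m i = \<alpha> * m + k"
        using R[OF c(1) True] by (simp_all add: i_def)
      have t: "t \<le> m" "\<And>l. l < t \<Longrightarrow> p (R (\<beta> * m + l)) \<le> p i"
        using I True by (auto simp: I_def k_def t_def i_def)
      have nb: "neighbours p (B k j) j (arrays s' ''p'' j) (arrays s' ''s'' j)" if "j < m * m" for j
        using I that by (auto simp: I_def k_def)
      have le: "arrays s' ''p'' i \<le> i" "arrays s' ''s'' i \<le> i"
        using neighbours_le[OF nb[OF i(1)]] by auto
      have word: "word E 0 = Some 0" "word E 1 = Some 1" "word E (\<alpha> * m + k) = Some (\<alpha> * m + k)"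
        "word E (\<beta> * m + t) = Some (\<beta> * m + t)" "word E (\<beta> * m + t - 1) = Some (\<beta> * m + t - 1)"
        "word E (k + 1) = Some (k + 1)" "word E (t + 1) = Some (t + 1)"
      proof -
        have "\<alpha> * m + k < m * m" "\<beta> * m < m * m" using True c index_less[of _ 0] index_less
          by auto
        then show "word E 0 = Some 0" "word E 1 = Some 1" "word E (\<alpha> * m + k) = Some (\<alpha> * m + k)"
        "word E (\<beta> * m + t) = Some (\<beta> * m + t)" "word E (\<beta> * m + t - 1) = Some (\<beta> * m + t - 1)"
        "word E (k + 1) = Some (k + 1)" "word E (t + 1) = Some (t + 1)"
          using bounds t(1) True by (intro word_Some; linarith)+
      qed
      note facts = regs i_def[symmetric] i(1) t(1) word le True
      show ?thesis
      proof (cases "t < m \<and> p (R (\<beta> * m + t)) \<le> p i")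
        case advance: True
        then have "\<forall>l<Suc t. p (R (\<beta> * m + l)) \<le> p i"
          using t(2) by (auto simp: less_Suc_eq)
        then show ?thesis
          using advance facts R[of \<beta> t] c fr nb
          apply (simp add: I_def frame_def diff_less_mono2)
          done
      next
        \<comment> \<open>If \<open>t\<close> cannot advance, then \<open>t = m\<close> or entry
          \<open>t\<close> is too large, and sortedness of column \<open>\<beta>\<close> extends
          this to all later entries. So \<open>t\<close> is the cut required by
          \<open>neighbours_merge\<close>.\<close>
        case False
        have gt: "p (R (\<beta> * m + l)) \<le> p i \<longleftrightarrow> l < t" if "l < m" for l
          using that t(2)[of l] False mono[of \<beta> t l] c by fastforce
        \<comment> \<open>Column \<open>\<beta>\<close> lies to the left of column
          \<open>\<alpha>\<close>, so its linear indices are smaller.\<close>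
        have less: "R (\<beta> * m + l) < i" if "l < m" for l
        proof -
          have "R (\<beta> * m + l) div m < i div m" using R(2)[of \<beta> l] c that i(2) by simp
          then show ?thesis by (meson div_le_mono leI not_less)
        qed
        define u where "u = (if 0 < t then improve le_p i (arrays s' ''p'' i) (R (\<beta> * m + t - 1))
          else arrays s' ''p'' i)"
        define v where "v = (if t < m then improve ge_p i (arrays s' ''s'' i) (R (\<beta> * m + t))
          else arrays s' ''s'' i)"
        have "neighbours p (B k i \<union> {j. j div m = \<beta>}) i u v"
          using neighbours_merge[OF nb[OF i(1)], where f = "\<lambda>l. R (\<beta> * m + l)" and m = m and t = t]
            mono[of \<beta>] c gt less t(1) unfolding column
          by (auto simp: u_def v_def)
        then have nb': "neighbours p (B (Suc k) j) j
           (((arrays s' ''p'')(i := u)) j) (((arrays s' ''s'')(i := v)) j)" if "j < m * m" for j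
        proof (cases "j = i")
          case True
          with \<open>neighbours p (B k i \<union> {j. j div m = \<beta>}) i u v\<close> i show ?thesis
            by (simp add: B_def)
        next
          case False
          then have "slot p m j \<noteq> \<alpha> * m + k" using i(3) slot_inject[OF m_pos] by metis
          then have "B (Suc k) j = B k j" by (auto simp: B_def)
          then show ?thesis using False nb[OF that] by simp
        qed
        have t': "\<forall>l<t. p (R (\<beta> * m + l)) \<le> p (R (\<alpha> * m + Suc k))" if "Suc k < m"
          using mono[of \<alpha> k "Suc k"] t(2) that c by (auto simp: i_def intro: order_trans)
        have dec: "(m - Suc k) + (m - t) < (m - k) + (m - t)" using True by simp
        note facts = facts fr t' dec nb'[unfolded u_def v_def]
        consider "t = 0" "t < m" | "0 < t" "t < m" | "0 < t" "t = m" using m_pos t(1) by linarith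
        then show ?thesis
        proof cases
          case 1
          then show ?thesis
            using facts False R(1)[of \<beta> t] c
            apply simp
            apply (rule run_improve_succ[where i = i and w = "R (\<beta> * m + t)"]; simp add: I_def frame_def)
            done
        next
          case 2
          then show ?thesis
            using facts False R(1)[of \<beta> t] R(1)[of \<beta> "t - 1"] c
            apply simp
            apply (rule run_improve_pred[where i = i and w = "R (\<beta> * m + t - 1)"]; simp)
            apply (rule run_improve_succ[where i = i and w = "R (\<beta> * m + t)"]; simp add: I_def frame_def)
            done
        next
          case 3
          then show ?thesis
            using facts False R(1)[of \<beta> "t - 1"] c
            apply simp
            apply (rule run_improve_pred[where i = i and w = "R (\<beta> * m + t - 1)"]; simp add: I_def frame_def)
            done
        qed
      qed
    qed
  qed
  then show ?thesis
  proof (rule run_mono, goal_cases)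
    case (1 t s')
    then have k: "regs s' ''k'' = m" using m frameD(1)[of _ _ s s' "''m''"] by (auto simp: I_def)
    have "B m i = (if i div m = \<alpha> then A i \<union> {j. j div m = \<beta>} else A i)" for i
      using rank_less[OF m_pos, of p i] by (auto simp: B_def slot_def)
    with 1 k s show ?case
      by (simp add: I_def frameD[of "{''k'', ''t'', ''i'', ''w''}" "{''p'', ''s''}" s s'])
  qed
qed

text \<open>The own column is included from the start, because sorting it already supplied its
  neighbours. An earlier column joins once the code of the pair is below the counter
  \<open>e\<close>.\<close>

definition merged :: "nat \<Rightarrow> nat \<Rightarrow> nat set" where
  "merged e i = {j. j div m = i div m \<or> (j div m < i div m \<and> i div m * m + j div m < e)}"

text \<open>By uniqueness of quotient and remainder, \<open>e\<close> encodes a single pair of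
  columns. Positions \<open>j < i\<close> are all that \<open>neighbours_cong\<close> asks
  for.\<close>

lemma merged_Suc:
  assumes "i < m * m" "j < i"
  shows "j \<in> merged (Suc e) i \<longleftrightarrow>
    j \<in> (if i div m = e div m \<and> e mod m < e div m then merged e i \<union> {j. j div m = e mod m} else merged e i)"
proof -
  have ij: "i div m < m" "j div m \<le> i div m"
    using assms m_pos by (auto simp: div_less_iff_less_mult intro: div_le_mono)
  have "i div m * m + j div m = e \<longleftrightarrow> i div m = e div m \<and> j div m = e mod m" if "j div m < i div m"
    using ij that by (metis div_mult_mod_eq div_mult_self3 add.right_neutral div_less mod_less
        mod_mult_self3 m_pos less_trans less_irrefl)
  then show ?thesis using ij by (auto simp: merged_def less_Suc_eq)
qed

lemma merged_all:
  assumes "i < m * m" "j < i"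
  shows "j \<in> merged (m * m) i"
proof -
  have "i div m < m" "j div m \<le> i div m"
    using assms m_pos by (auto simp: div_less_iff_less_mult intro: div_le_mono)
  then show ?thesis using index_less[of "i div m" "j div m"] by (auto simp: merged_def)
qed

definition linked :: "state \<Rightarrow> bool" where
  "linked s \<longleftrightarrow> (\<forall>i<m * m. neighbours p {..<i} i (arrays s ''p'' i) (arrays s ''s'' i))"

lemma run_merge_columns:
  assumes "base s" "\<forall>i<m * m. column_sorted i s"
  shows "run E merge_columns s (\<lambda>t s'. t \<le> m * m * (m * 400 + 100) + 10 \<and> base s' \<and> linked s')"
proof -
  define I where "I s' \<longleftrightarrow> base s' \<and> regs s' ''e'' \<le> m * m \<and> arrays s' ''o'' = arrays s ''o'' \<and>
    (\<forall>i<m * m. neighbours p (merged (regs s' ''e'') i) i (arrays s' ''p'' i) (arrays s' ''s'' i))" for s'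
  have "merged 0 i = {j. j div m = i div m}" for i by (auto simp: merged_def)
  then have I0: "I (s\<lparr>regs := (regs s)(''e'' := 0)\<rparr>)"
    using assms by (simp add: I_def base_def column_sorted_def)
  have sorted: "arrays s ''o'' (slot p m i) = i" if "i < m * m" for i
    using assms that by (simp add: column_sorted_def)
  have loop: "run E (While (Less (Var ''e'') (Var ''N''))
       (If (Less (Op Mod (Var ''e'') (Var ''m'')) (Op Div (Var ''e'') (Var ''m'')))
          (Assign ''a'' (Op Mul (Op Div (Var ''e'') (Var ''m'')) (Var ''m'')) ;;
           Assign ''b'' (Op Mul (Op Mod (Var ''e'') (Var ''m'')) (Var ''m'')) ;;
           Assign ''k'' (Const 0) ;;
           Assign ''t'' (Const 0) ;;
           merge_pair)
          Skip ;;
        inc ''e'')) s1 (\<lambda>t s'. I s' \<and> bval E s' (Less (Var ''e'') (Var ''N'')) = Some False \<and>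
    t \<le> (m * m - regs s1 ''e'') * (m * 400 + 100) + 1 + bcost (Less (Var ''e'') (Var ''N'')))"
    if "I s1" for s1
  proof (rule run_While_count[where f = "\<lambda>s. m * m - regs s ''e''"], goal_cases)
    case 1
    show ?case by (fact that)
  next
    case (2 s')
    define e where "e = regs s' ''e''"
    have regs: "regs s' ''e'' = e" "regs s' ''m'' = m" "regs s' ''n'' = n" "regs s' ''N'' = m * m"
      "reported s' = []" "arrays s' ''o'' = arrays s ''o''"
      using 2 by (simp_all add: I_def base_def e_def)
    have nb: "neighbours p (merged e i) i (arrays s' ''p'' i) (arrays s' ''s'' i)" if "i < m * m" for i
      using 2 that by (simp add: I_def e_def)
    show ?case
    proof (cases "e < m * m")
      case False
      then show ?thesis using regs by simp
    next
      case True
      then have ab: "e div m < m" "e mod m < m"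
        using m_pos by (auto simp: div_less_iff_less_mult)
      have "e div m * m < m * m" "e mod m * m < m * m"
        using index_less[OF ab(1) m_pos] index_less[OF ab(2) m_pos] by simp_all
      then have word: "word E 0 = Some 0" "word E 1 = Some 1" "word E (e mod m) = Some (e mod m)"
        "word E (e div m) = Some (e div m)" "word E (e div m * m) = Some (e div m * m)"
        "word E (e mod m * m) = Some (e mod m * m)" "word E (e + 1) = Some (e + 1)"
        using True ab bounds by (intro word_Some; linarith)+
      have dec: "m * m - Suc e < m * m - e" using True by simp
      have step: "neighbours p (merged (Suc e) i) i u v"
        if "neighbours p (if i div m = e div m \<and> e mod m < e div m
          then merged e i \<union> {j. j div m = e mod m} else merged e i) i u v" "i < m * m" for i u v
        using that(1) neighbours_cong[OF merged_Suc[OF that(2)]] by blast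
      show ?thesis
      proof (cases "e mod m < e div m")
        case lt: True
        show ?thesis
          using regs True word lt ab dec
          apply simp
          apply (rule run_mono[OF run_merge_pair[where \<alpha> = "e div m" and \<beta> = "e mod m" and A = "merged e"]];
              simp add: nb sorted)
          apply (elim conjE)
          using step
          apply (simp add: I_def base_def)
          done
      next
        case False
        then show ?thesis
          using regs True word dec nb step by (simp add: I_def base_def)
      qed
    qed
  qed
  have final: "base s' \<and> linked s'" if "I s'" "\<not> regs s' ''e'' < regs s' ''N''" for s'
    unfolding linked_def
  proof (intro conjI allI impI)
    show "base s'" using that(1) by (simp add: I_def)
    have "regs s' ''e'' = m * m" using that by (simp add: I_def base_def)
    fix i assume i: "i < m * m"
    then have "neighbours p (merged (m * m) i) i (arrays s' ''p'' i) (arrays s' ''s'' i)"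
      using that(1) \<open>regs s' ''e'' = m * m\<close> by (simp add: I_def)
    moreover have "j \<in> merged (m * m) i \<longleftrightarrow> j \<in> {..<i}" if "j < i" for j
      using merged_all[OF i that] that by simp
    ultimately show "neighbours p {..<i} i (arrays s' ''p'' i) (arrays s' ''s'' i)"
      using neighbours_cong by blast
  qed
  from loop[OF I0] show ?thesis
    using assms bounds unfolding merge_columns_def
    apply simp
    apply (erule run_mono)
    apply (simp add: final)
    done
qed

end

section \<open>Self-overlaps of the pattern\<close>

definition Iff :: "bexp \<Rightarrow> bexp \<Rightarrow> bexp" where
  "Iff b c = And (Not (And b (Not c))) (Not (And c (Not b)))"

lemma bval_Iff [simp]:
  "bval E s b = Some u \<Longrightarrow> bval E s c = Some v \<Longrightarrow> bval E s (Iff b c) = Some (u \<longleftrightarrow> v)"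
  by (auto simp: Iff_def)

text \<open>The accessor \<open>f\<close> is a parameter, so that one test serves both the shifted
  pattern and the text windows.\<close>

definition agrees :: "(aexp \<Rightarrow> entry) \<Rightarrow> name \<Rightarrow> bexp" where
  "agrees f a =
     And (Iff (Entry_Le (f (Var ''q'')) (f (Load a (Var ''q''))))
              (Entry_Le (cell (Var ''q'')) (cell (Load a (Var ''q'')))))
         (Iff (Entry_Le (f (Load a (Var ''q''))) (f (Var ''q'')))
              (Entry_Le (cell (Load a (Var ''q''))) (cell (Var ''q''))))"

definition extends :: "(aexp \<Rightarrow> entry) \<Rightarrow> bexp" where
  "extends f = And (agrees f ''p'') (agrees f ''s'')"

definition shifted_cell :: "aexp \<Rightarrow> entry" where
  "shifted_cell a = cell (Op Add (Var ''c'') a)"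

definition self_overlap :: com where
  "self_overlap =
     While (And (Less (Op Add (Var ''c'') (Var ''q'')) (Var ''N'')) (extends shifted_cell))
       (inc ''q'')"

definition self_overlaps :: com where
  "self_overlaps =
     Assign ''h'' (Const 1) ;;
     While (Not (Less (Var ''m'') (Var ''h'')))
       (Assign ''c'' (Op Mul (Var ''h'') (Var ''m'')) ;;
        Assign ''q'' (Const 0) ;;
        self_overlap ;;
        Store ''z'' (Var ''h'') (Var ''q'') ;;
        inc ''h'')"

context matching
begin

text \<open>The stored neighbours are at most \<open>q\<close>, so \<open>f\<close> is evaluated
  only at \<open>q\<close> and below; \<open>order_match_Suc_iff\<close> then turns the comparisons
  into the extension.\<close>

lemma bval_extends:
  assumes "regs s ''q'' = q" "regs s ''m'' = m" "q < m * m" "linked s" "order_match q g p"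
    and "entry_val E s (f (Var ''q'')) = Some (g q)"
    and "\<And>a. arrays s a q \<le> q \<Longrightarrow> entry_val E s (f (Load a (Var ''q''))) = Some (g (arrays s a q))"
  shows "bval E s (extends f) = Some (order_match (Suc q) g p)"
proof -
  have nb: "neighbours p {..<q} q (arrays s ''p'' q) (arrays s ''s'' q)"
    using assms(3,4) by (simp add: linked_def)
  have le: "arrays s ''p'' q \<le> q" "arrays s ''s'' q \<le> q"
    using neighbours_le[OF nb] by auto
  have "bval E s (agrees f a) = Some ((g q \<le> g (arrays s a q) \<longleftrightarrow> p q \<le> p (arrays s a q)) \<and>
      (g (arrays s a q) \<le> g q \<longleftrightarrow> p (arrays s a q) \<le> p q))" if "arrays s a q \<le> q" for a
  proof -
    have "bval E s (Entry_Le (f (Var ''q'')) (f (Load a (Var ''q'')))) = Some (g q \<le> g (arrays s a q))"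
      "bval E s (Entry_Le (f (Load a (Var ''q''))) (f (Var ''q''))) = Some (g (arrays s a q) \<le> g q)"
      "bval E s (Entry_Le (cell (Var ''q'')) (cell (Load a (Var ''q'')))) = Some (p q \<le> p (arrays s a q))"
      "bval E s (Entry_Le (cell (Load a (Var ''q''))) (cell (Var ''q''))) = Some (p (arrays s a q) \<le> p q)"
      using assms that by simp_all
    from bval_Iff[OF this(1,3)] bval_Iff[OF this(2,4)] show ?thesis
      by (simp add: agrees_def)
  qed
  from this[OF le(1)] this[OF le(2)] show ?thesis
    unfolding extends_def order_match_Suc_iff[OF assms(5) nb] by simp
qed

text \<open>Matches are closed under prefixes, so a single threshold describes all of them. For
  \<open>h = m\<close> only the empty prefix remains.\<close>

definition overlap :: "nat \<Rightarrow> nat \<Rightarrow> bool" where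
  "overlap h v \<longleftrightarrow> h * m + v \<le> m * m \<and>
     (\<forall>q. h * m + q \<le> m * m \<longrightarrow> (order_match q (\<lambda>i. p (h * m + i)) p \<longleftrightarrow> q \<le> v))"

lemma run_self_overlap:
  assumes "base s" "linked s" "regs s ''c'' = h * m" "regs s ''q'' = 0" "h \<le> m"
  shows "run E self_overlap s (\<lambda>t s'. t \<le> m * m * 1000 + 1000 \<and> base s' \<and> linked s' \<and>
    regs s' ''h'' = regs s ''h'' \<and> arrays s' ''z'' = arrays s ''z'' \<and>
    overlap h (regs s' ''q''))"
proof -
  let ?g = "\<lambda>i. p (h * m + i)"
  let ?b = "And (Less (Op Add (Var ''c'') (Var ''q'')) (Var ''N'')) (extends shifted_cell)"
  define I where "I s' \<longleftrightarrow> base s' \<and> linked s' \<and> regs s' ''c'' = h * m \<and>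
    regs s' ''h'' = regs s ''h'' \<and> arrays s' ''z'' = arrays s ''z'' \<and>
    h * m + regs s' ''q'' \<le> m * m \<and> order_match (regs s' ''q'') ?g p" for s'
  have hm: "h * m \<le> m * m" using assms by simp
  have b: "bval E s' ?b = Some (h * m + regs s' ''q'' < m * m \<and> order_match (Suc (regs s' ''q'')) ?g p)"
    if I: "I s'" for s'
  proof -
    have word: "word E (h * m + regs s' ''q'') = Some (h * m + regs s' ''q'')"
    proof (rule word_Some)
      have "h * m + regs s' ''q'' \<le> m * m" using I by (simp add: I_def)
      then show "h * m + regs s' ''q'' \<le> 8 * (n * n)" using bounds by linarith
    qed
    show ?thesis
    proof (cases "h * m + regs s' ''q'' < m * m")
      case False
      then show ?thesis using I word by (simp add: I_def base_def)
    next
      case True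
      have "bval E s' (extends shifted_cell) = Some (order_match (Suc (regs s' ''q'')) ?g p)"
      proof (rule bval_extends)
        fix a assume "arrays s' a (regs s' ''q'') \<le> regs s' ''q''"
        then have "h * m + arrays s' a (regs s' ''q'') < m * m" using True by simp
        moreover from this have "word E (h * m + arrays s' a (regs s' ''q'')) =
            Some (h * m + arrays s' a (regs s' ''q''))"
          using bounds by (intro word_Some) linarith
        ultimately show "entry_val E s' (shifted_cell (Load a (Var ''q''))) =
            Some (p (h * m + arrays s' a (regs s' ''q'')))"
          using I by (simp add: shifted_cell_def I_def base_def)
      qed (use I True word in \<open>simp_all add: shifted_cell_def I_def base_def\<close>)
      then show ?thesis using I True word by (simp add: I_def base_def)
    qed
  qed
  have "run E self_overlap s (\<lambda>t s'. I s' \<and> bval E s' ?b = Some False \<and>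
      t \<le> (m * m - regs s ''q'') * 1000 + 1 + bcost ?b)"
    unfolding self_overlap_def
  proof (rule run_While_count[where f = "\<lambda>s. m * m - regs s ''q''"], goal_cases)
    case 1
    show ?case using assms hm by (simp add: I_def)
  next
    case (2 s')
    have "h * m + regs s' ''q'' \<le> m * m" using 2 by (simp add: I_def)
    then have word: "word E 1 = Some 1" "word E (regs s' ''q'' + 1) = Some (regs s' ''q'' + 1)"
      using bounds by (intro word_Some; linarith)+
    have dec: "m * m - Suc (regs s' ''q'') < m * m - regs s' ''q''" if "h * m + regs s' ''q'' < m * m"
      using that by simp
    show ?case
      unfolding b[OF 2]
      using 2 word dec
      apply (simp add: I_def base_def linked_def extends_def agrees_def Iff_def shifted_cell_def)
      done
  qed
  then show ?thesis
  proof (rule run_mono, goal_cases)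
    case (1 t s')
    then have I: "I s'" and "bval E s' ?b = Some False" by blast+
    with b[OF I] have stop: "\<not> (h * m + regs s' ''q'' < m * m \<and> order_match (Suc (regs s' ''q'')) ?g p)"
      by (metis option.inject)
    have q: "h * m + regs s' ''q'' \<le> m * m" "order_match (regs s' ''q'') ?g p"
      using I by (simp_all add: I_def)
    \<comment> \<open>A longer match would contain the one-step extension that the loop condition
      has just refuted.\<close>
    have "r \<le> regs s' ''q''" if "h * m + r \<le> m * m" "order_match r ?g p" for r
    proof (rule ccontr)
      assume "\<not> r \<le> regs s' ''q''"
      then have "h * m + regs s' ''q'' < m * m" "Suc (regs s' ''q'') \<le> r" using that(1) by linarith+
      then show False using stop order_match_mono[OF that(2)] by blast
    qed
    then have "overlap h (regs s' ''q'')"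
      unfolding overlap_def using q(1) order_match_mono[OF q(2)] by blast
    moreover have "t \<le> (m * m - regs s ''q'') * 1000 + 1 + bcost ?b" using 1 by blast
    ultimately show ?case using I assms(4)
      by (simp add: I_def extends_def agrees_def Iff_def shifted_cell_def)
  qed
qed

lemma run_self_overlaps:
  assumes "base s" "linked s"
  shows "run E self_overlaps s (\<lambda>t s'. t \<le> m * (m * m * 1000 + 1500) + 10 \<and> base s' \<and> linked s' \<and>
    (\<forall>h\<in>{1..m}. overlap h (arrays s' ''z'' h)))"
proof -
  define I where "I s' \<longleftrightarrow> base s' \<and> linked s' \<and> 1 \<le> regs s' ''h'' \<and> regs s' ''h'' \<le> m + 1 \<and>
    (\<forall>h\<in>{1..<regs s' ''h''}. overlap h (arrays s' ''z'' h))" for s'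
  have I0: "I (s\<lparr>regs := (regs s)(''h'' := 1)\<rparr>)"
    using assms by (simp add: I_def base_def linked_def)
  have loop: "run E (While (Not (Less (Var ''m'') (Var ''h'')))
       (Assign ''c'' (Op Mul (Var ''h'') (Var ''m'')) ;;
        Assign ''q'' (Const 0) ;;
        self_overlap ;;
        Store ''z'' (Var ''h'') (Var ''q'') ;;
        inc ''h'')) s1 (\<lambda>t s'. I s' \<and> bval E s' (Not (Less (Var ''m'') (Var ''h''))) = Some False \<and>
    t \<le> (m + 1 - regs s1 ''h'') * (m * m * 1000 + 1500) + 1 + bcost (Not (Less (Var ''m'') (Var ''h''))))"
    if "I s1" for s1
  proof (rule run_While_count[where f = "\<lambda>s. m + 1 - regs s ''h''"], goal_cases)
    case 1
    show ?case by (fact that)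
  next
    case (2 s')
    define h where "h = regs s' ''h''"
    have regs: "regs s' ''h'' = h" "regs s' ''m'' = m" "regs s' ''n'' = n" "regs s' ''N'' = m * m"
      "reported s' = []" "1 \<le> h"
      using 2 by (simp_all add: I_def base_def h_def)
    have old: "overlap k (arrays s' ''z'' k)" if "1 \<le> k" "k < h" for k
      using 2 that by (simp add: I_def h_def)
    have linked: "linked (s'\<lparr>regs := f\<rparr>)" for f using 2 by (simp add: I_def linked_def)
    show ?case
    proof (cases "h \<le> m")
      case False
      then show ?thesis using regs by simp
    next
      case True
      then have "h * m \<le> m * m" by simp
      then have word: "word E 0 = Some 0" "word E 1 = Some 1" "word E (h * m) = Some (h * m)"
        "word E (h + 1) = Some (h + 1)"
        using True bounds by (intro word_Some; linarith)+
      have dec: "m - h < Suc m - h" using True by simp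
      show ?thesis
        using regs True word linked dec
        apply simp
        apply (rule run_mono[OF run_self_overlap[where h = h]]; simp add: base_def)
        apply (elim conjE)
        using old
        apply (auto simp: I_def base_def linked_def less_Suc_eq)
        done
    qed
  qed
  have final: "base s' \<and> linked s' \<and> (\<forall>h\<in>{1..m}. overlap h (arrays s' ''z'' h))"
    if "I s'" "regs s' ''m'' < regs s' ''h''" for s'
    using that by (auto simp: I_def base_def)
  have "word E 1 = Some 1" using bounds by (intro word_Some) linarith
  with loop[OF I0] show ?thesis
    unfolding self_overlaps_def
    apply simp
    apply (erule run_mono)
    apply (simp add: final)
    done
qed

end

section \<open>Searching the text\<close>

definition text_cell :: "aexp \<Rightarrow> entry" where
  "text_cell a = Text_Entry (Op Add (Op Add (Var ''x'') (Op Div a (Var ''m''))) (Const 1))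
                            (Op Add (Op Add (Var ''y'') (Op Mod a (Var ''m''))) (Const 1))"

text \<open>A shift by \<open>h\<close> columns is compatible with the \<open>q\<close> matched
  entries iff the self-match for \<open>h\<close> covers the remaining \<open>q - h * m\<close> of
  them.\<close>

definition find_shift :: com where
  "find_shift =
     Assign ''h'' (Const 1) ;;
     While (Less (Op Add (Op Mul (Var ''h'') (Var ''m'')) (Load ''z'' (Var ''h''))) (Var ''q''))
       (inc ''h'')"

text \<open>After its report, a complete match is treated like a mismatch at position
  \<open>m * m\<close>. The final subtraction truncates to 0 if the shift leaves all matched entries
  behind.\<close>

definition search_strip :: com where
  "search_strip =
     Assign ''x'' (Const 0) ;;
     Assign ''q'' (Const 0) ;;
     While (Not (Less (Var ''n'') (Op Add (Var ''x'') (Var ''m''))))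
       (If (And (Less (Var ''q'') (Var ''N'')) (extends text_cell))
          (inc ''q'')
          (If (Equal (Var ''q'') (Var ''N''))
             (Report (Op Add (Var ''x'') (Const 1)) (Op Add (Var ''y'') (Const 1))) Skip ;;
           find_shift ;;
           Assign ''x'' (Op Add (Var ''x'') (Var ''h'')) ;;
           Assign ''q'' (Op Sub (Var ''q'') (Op Mul (Var ''h'') (Var ''m'')))))"

definition search :: com where
  "search =
     Assign ''y'' (Const 0) ;;
     While (Not (Less (Var ''n'') (Op Add (Var ''y'') (Var ''m''))))
       (search_strip ;; inc ''y'')"

definition pattern_matching :: com where
  "pattern_matching =
     If (Less (Var ''n'') (Var ''m'')) Skip
       (Assign ''N'' (Op Mul (Var ''m'') (Var ''m'')) ;;
        sort_columns ;; merge_columns ;; self_overlaps ;; search)"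

context matching
begin

section \<open>Text windows and safe shifts\<close>

definition window :: "nat \<Rightarrow> nat \<Rightarrow> nat \<Rightarrow> int" where
  "window x y i = T (x + i div m + 1) (y + i mod m + 1)"

text \<open>Here reading by columns pays off: moving the window sideways shifts the linear string by
  a multiple of \<open>m\<close>.\<close>

lemma window_shift: "window (x + h) y i = window x y (h * m + i)"
  using m_pos by (simp add: window_def add.assoc)

lemma text_cell_val:
  assumes "aval E s a = Some i" "i < m * m" "regs s ''m'' = m"
    and "regs s ''x'' = x" "regs s ''y'' = y" "x + m \<le> n" "y + m \<le> n"
  shows "entry_val E s (text_cell a) = Some (window x y i)"
proof -
  have "i div m < m" "i mod m < m"
    using assms(2) m_pos by (auto simp: div_less_iff_less_mult)
  then have "x + i div m + 1 \<le> n" "y + i mod m + 1 \<le> n" using assms(6,7) by linarith+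
  moreover from this have "word E 1 = Some 1" "word E (i div m) = Some (i div m)"
    "word E (i mod m) = Some (i mod m)" "word E (x + i div m) = Some (x + i div m)"
    "word E (y + i mod m) = Some (y + i mod m)"
    "word E (x + i div m + 1) = Some (x + i div m + 1)"
    "word E (y + i mod m + 1) = Some (y + i mod m + 1)"
    using bounds by (intro word_Some; linarith)+
  ultimately show ?thesis
    using assms by (simp add: text_cell_def window_def lookup_def)
qed

text \<open>Chained with the match at \<open>x\<close>, a full match \<open>h\<close> columns
  further would make the pattern match its own shift on \<open>q - h * m > v\<close> entries, beyond
  the longest self-match.\<close>

lemma no_match_between:
  assumes "order_match q (window x y) p" "q \<le> m * m" "overlap h v" "h * m + v < q"
  shows "\<not> order_match (m * m) (window (x + h) y) p"
proof
  assume full: "order_match (m * m) (window (x + h) y) p"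
  define r where "r = q - h * m"
  have r: "h * m + r = q" using assms(4) by (simp add: r_def)
  have "order_match r (\<lambda>i. window x y (h * m + i)) (\<lambda>i. p (h * m + i))"
    by (rule order_match_shift[OF assms(1)]) (simp add: r)
  moreover have "order_match r (window (x + h) y) p"
    by (rule order_match_mono[OF full]) (use r assms(2) in simp)
  then have "order_match r (\<lambda>i. window x y (h * m + i)) p"
    by (simp add: window_shift[abs_def])
  ultimately have "order_match r (\<lambda>i. p (h * m + i)) p"
    by (metis order_match_sym order_match_trans)
  then have "r \<le> v" using assms(2,3) r by (simp add: overlap_def)
  then show False using assms(4) r by simp
qed

text \<open>Transitivity chains window, shifted pattern and pattern, so nothing is compared again.
  If \<open>q < h * m\<close>, the claim concerns the empty prefix.\<close>

lemma match_after_shift: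
  assumes "order_match q (window x y) p" "q \<le> m * m" "overlap h v" "q \<le> h * m + v"
  shows "order_match (q - h * m) (window (x + h) y) p"
proof (cases "h * m \<le> q")
  case True
  define r where "r = q - h * m"
  have r: "h * m + r = q" "r \<le> v" using True assms(4) by (simp_all add: r_def)
  have "order_match r (\<lambda>i. window x y (h * m + i)) (\<lambda>i. p (h * m + i))"
    by (rule order_match_shift[OF assms(1)]) (simp add: r)
  moreover have "order_match r (\<lambda>i. p (h * m + i)) p"
    using assms(2,3) r by (simp add: overlap_def)
  ultimately have "order_match r (\<lambda>i. window x y (h * m + i)) p"
    by (rule order_match_trans)
  then show ?thesis by (simp add: window_shift[abs_def] r_def)
qed simp

text \<open>The cost is proportional to the shift found, which is what makes the scan of a strip linear.\<close>

lemma run_find_shift: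
  assumes m: "regs s ''m'' = m" and q: "regs s ''q'' \<le> m * m"
    and z: "\<forall>h\<in>{1..m}. overlap h (arrays s ''z'' h)"
  obtains h where "1 \<le> h" "h \<le> m" "regs s ''q'' \<le> h * m + arrays s ''z'' h"
    "\<And>k. 1 \<le> k \<Longrightarrow> k < h \<Longrightarrow> k * m + arrays s ''z'' k < regs s ''q''"
    "run E find_shift s (\<lambda>t s'. t \<le> h * 20 + 20 \<and> s' = s\<lparr>regs := (regs s)(''h'' := h)\<rparr>)"
proof -
  define H where "H = (LEAST h. 1 \<le> h \<and> regs s ''q'' \<le> h * m + arrays s ''z'' h)"
  \<comment> \<open>The shift by \<open>m\<close> columns always qualifies, so the trials stop at
    \<open>m\<close> at the latest.\<close>
  have ex: "1 \<le> m \<and> regs s ''q'' \<le> m * m + arrays s ''z'' m"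
    using m_pos q by simp
  have H: "1 \<le> H" "regs s ''q'' \<le> H * m + arrays s ''z'' H"
    using LeastI[of "\<lambda>h. 1 \<le> h \<and> regs s ''q'' \<le> h * m + arrays s ''z'' h", OF ex]
    by (simp_all add: H_def)
  have "H \<le> m" unfolding H_def by (rule Least_le) (rule ex)
  have less: "k * m + arrays s ''z'' k < regs s ''q''" if "1 \<le> k" "k < H" for k
    using not_less_Least[of k "\<lambda>h. 1 \<le> h \<and> regs s ''q'' \<le> h * m + arrays s ''z'' h"] that
    by (simp add: H_def)
  define I where "I s' \<longleftrightarrow> (\<exists>k. s' = s\<lparr>regs := (regs s)(''h'' := k)\<rparr> \<and> 1 \<le> k \<and> k \<le> H)" for s'
  let ?b = "Less (Op Add (Op Mul (Var ''h'') (Var ''m'')) (Load ''z'' (Var ''h''))) (Var ''q'')"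
  have b: "bval E s' ?b = Some (regs s' ''h'' < H)" if I: "I s'" for s'
  proof -
    obtain k where k: "s' = s\<lparr>regs := (regs s)(''h'' := k)\<rparr>" "1 \<le> k" "k \<le> H"
      using I unfolding I_def by blast
    have "k * m + arrays s ''z'' k \<le> m * m" using z k \<open>H \<le> m\<close> by (simp add: overlap_def)
    then have "word E (k * m) = Some (k * m)"
      "word E (k * m + arrays s ''z'' k) = Some (k * m + arrays s ''z'' k)"
      using bounds by (intro word_Some; linarith)+
    moreover have "k * m + arrays s ''z'' k < regs s ''q'' \<longleftrightarrow> k < H"
      using less[of k] H(2) k by (cases "k = H") auto
    ultimately show ?thesis using m by (simp add: k(1))
  qed
  have stop: "s' = s\<lparr>regs := (regs s)(''h'' := H)\<rparr>" if "I s'" "bval E s' ?b = Some False" for s'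
  proof -
    have "\<not> regs s' ''h'' < H" using b[OF that(1)] that(2) by (metis option.inject)
    with that(1) show ?thesis by (auto simp: I_def)
  qed
  have word: "word E 1 = Some 1" using bounds by (intro word_Some) linarith
  have "run E (While ?b (inc ''h'')) (s\<lparr>regs := (regs s)(''h'' := 1)\<rparr>)
    (\<lambda>t s'. I s' \<and> bval E s' ?b = Some False \<and>
      t \<le> (H - regs (s\<lparr>regs := (regs s)(''h'' := 1)\<rparr>) ''h'') * 20 + 1 + bcost ?b)"
  proof (rule run_While_count[where f = "\<lambda>s. H - regs s ''h''"], goal_cases)
    case 1
    show ?case using H by (auto simp: I_def)
  next
    case (2 s')
    then obtain k where k: "s' = s\<lparr>regs := (regs s)(''h'' := k)\<rparr>" "1 \<le> k" "k \<le> H"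
      unfolding I_def by blast
    have "word E (k + 1) = Some (k + 1)"
      using k(3) \<open>H \<le> m\<close> bounds by (intro word_Some) linarith
    then show ?case
      unfolding b[OF 2] using k word by (auto simp: I_def)
  qed
  then have "run E find_shift s (\<lambda>t s'. t \<le> H * 20 + 20 \<and> s' = s\<lparr>regs := (regs s)(''h'' := H)\<rparr>)"
    using word H(1) unfolding find_shift_def
    apply simp
    apply (erule run_mono)
    apply (use stop in simp)
    apply linarith
    done
  with that H \<open>H \<le> m\<close> less show thesis by blast
qed

section \<open>Scanning the strips\<close>

definition ready :: "state \<Rightarrow> bool" where
  "ready s \<longleftrightarrow> regs s ''n'' = n \<and> regs s ''m'' = m \<and> regs s ''N'' = m * m \<and> linked s \<and>
     (\<forall>h\<in>{1..m}. overlap h (arrays s ''z'' h))"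

definition matches :: "nat \<Rightarrow> nat \<Rightarrow> bool" where
  "matches x y \<longleftrightarrow> x + m \<le> n \<and> order_match (m * m) (window x y) p"

lemma run_search_strip:
  assumes "ready s" and y: "regs s ''y'' = y" "y + m \<le> n"
    and rep: "distinct (reported s)" "\<forall>x. (x, y + 1) \<notin> set (reported s)"
  shows "run E search_strip s (\<lambda>t s'. t \<le> (n * m + n) * 2000 + 20 \<and> ready s' \<and>
    regs s' ''y'' = y \<and> distinct (reported s') \<and>
    set (reported s') = set (reported s) \<union> {(x + 1, y + 1) | x. matches x y})"
proof -
  \<comment> \<open>The last shift may overshoot \<open>n - m\<close> by up to \<open>m\<close>
    columns, hence only \<open>x \<le> n\<close>.\<close>
  define I where "I s' \<longleftrightarrow> ready s' \<and> regs s' ''y'' = y \<and> regs s' ''x'' \<le> n \<and>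
    regs s' ''q'' \<le> m * m \<and> regs s' ''x'' * m + regs s' ''q'' \<le> n * m \<and>
    order_match (regs s' ''q'') (window (regs s' ''x'') y) p \<and> distinct (reported s') \<and>
    set (reported s') =
      set (reported s) \<union> {(x + 1, y + 1) | x. x < regs s' ''x'' \<and> matches x y}" for s'
  have I0: "I (s\<lparr>regs := (regs s)(''x'' := 0, ''q'' := 0)\<rparr>)"
    using assms by (simp add: I_def ready_def linked_def)
  \<comment> \<open>An extension raises \<open>x * m + q\<close> by one. A shift by \<open>h\<close>
    never lowers it and raises \<open>x\<close> by \<open>h\<close>, which pays for the trials of
    \<open>find_shift\<close>.\<close>
  define \<mu> where "\<mu> s = ((n * m - (regs s ''x'' * m + regs s ''q'')) + (n - regs s ''x'')) * 2000" for s :: state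
  let ?b = "Not (Less (Var ''n'') (Op Add (Var ''x'') (Var ''m'')))"
  have loop: "run E (While ?b
       (If (And (Less (Var ''q'') (Var ''N'')) (extends text_cell))
          (inc ''q'')
          (If (Equal (Var ''q'') (Var ''N''))
             (Report (Op Add (Var ''x'') (Const 1)) (Op Add (Var ''y'') (Const 1))) Skip ;;
           find_shift ;;
           Assign ''x'' (Op Add (Var ''x'') (Var ''h'')) ;;
           Assign ''q'' (Op Sub (Var ''q'') (Op Mul (Var ''h'') (Var ''m'')))))) s1
    (\<lambda>t s'. I s' \<and> bval E s' ?b = Some False \<and> t \<le> \<mu> s1 + 1 + bcost ?b)" if "I s1" for s1
  proof (rule run_While[where \<mu> = \<mu>], goal_cases)
    case 1
    show ?case by (fact that)
  next
    case (2 s')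
    note I = this
    define x q where "x = regs s' ''x''" and "q = regs s' ''q''"
    have regs: "regs s' ''m'' = m" "regs s' ''n'' = n" "regs s' ''N'' = m * m" "regs s' ''x'' = x"
      "regs s' ''q'' = q" "regs s' ''y'' = y" "linked s'"
      using I by (simp_all add: I_def ready_def x_def q_def)
    have z: "\<forall>h\<in>{1..m}. overlap h (arrays s' ''z'' h)"
      and q: "q \<le> m * m" "x * m + q \<le> n * m" "order_match q (window x y) p" and x: "x \<le> n"
      and reported: "distinct (reported s')" "set (reported s') =
        set (reported s) \<union> {(x' + 1, y + 1) | x'. x' < x \<and> matches x' y}"
      using I by (simp_all add: I_def ready_def x_def q_def)
    have word: "word E 1 = Some 1" "word E (x + m) = Some (x + m)" "word E (q + 1) = Some (q + 1)"
      "word E (x + 1) = Some (x + 1)" "word E (y + 1) = Some (y + 1)"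
      using x q y bounds by (intro word_Some; linarith)+
    have ext: "bval E s' (extends text_cell) = Some (order_match (Suc q) (window x y) p)"
      if "x + m \<le> n" "q < m * m"
    proof (rule bval_extends)
      fix a assume "arrays s' a q \<le> q"
      then show "entry_val E s' (text_cell (Load a (Var ''q''))) = Some (window x y (arrays s' a q))"
        using that regs y by (intro text_cell_val) simp_all
    next
      show "entry_val E s' (text_cell (Var ''q'')) = Some (window x y q)"
        using that regs y by (intro text_cell_val) simp_all
    qed (use regs that q in simp_all)
    show ?case
    proof (cases "x + m \<le> n")
      case False
      then show ?thesis using regs word by simp
    next
      case xm: True
      show ?thesis
      proof (cases "q < m * m \<and> order_match (Suc q) (window x y) p")
        case True
        have "(x + m) * m \<le> n * m" using xm by (intro mult_right_mono) auto
        then have lt: "x * m + q < n * m" using True by (simp add: add_mult_distrib)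
        then have "Suc (n * m - Suc (x * m + q)) = n * m - (x * m + q)" by simp
        then show ?thesis
          using regs word True ext xm z x reported lt y
          apply (simp add: I_def ready_def linked_def \<mu>_def)
          apply (simp add: extends_def agrees_def Iff_def text_cell_def)
          done
      next
        case False
        \<comment> \<open>Outside the extension case the scan stands at a full match or at a
          mismatch that refutes one.\<close>
        have found: "matches x y \<longleftrightarrow> q = m * m"
        proof (cases "q = m * m")
          case True
          then show ?thesis using q xm by (simp add: matches_def)
        next
          case neq: False
          then have "q < m * m" "\<not> order_match (Suc q) (window x y) p" using False q by auto
          then show ?thesis
            using order_match_mono[of "m * m" "window x y" p "Suc q"] by (auto simp: matches_def)
        qed
        \<comment> \<open>\<open>r\<close> and \<open>s2\<close> unite the two ways of reaching
          \<open>find_shift\<close>, with and without a report.\<close>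
        define r where "r = (if q = m * m then (x + 1, y + 1) # reported s' else reported s')"
        have r: "distinct r" "set r =
            set (reported s) \<union> {(x' + 1, y + 1) | x'. x' < Suc x \<and> matches x' y}"
          using reported rep(2) found by (auto simp: r_def less_Suc_eq)
        define s2 where "s2 = s'\<lparr>reported := r\<rparr>"
        obtain h where h: "1 \<le> h" "h \<le> m" "q \<le> h * m + arrays s' ''z'' h"
          "\<And>k. 1 \<le> k \<Longrightarrow> k < h \<Longrightarrow> k * m + arrays s' ''z'' k < q"
          "run E find_shift s2 (\<lambda>t s'. t \<le> h * 20 + 20 \<and> s' = s2\<lparr>regs := (regs s2)(''h'' := h)\<rparr>)"
          using run_find_shift[of s2] regs z q(1) by (auto simp: s2_def)
        have xh: "x + h \<le> n" using xm h(2) by simp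
        have hm: "h * m \<le> m * m" using h(2) by simp
        have word': "word E (h * m) = Some (h * m)" "word E (x + h) = Some (x + h)"
          "word E (q - h * m) = Some (q - h * m)"
          using hm xh q(1) bounds by (intro word_Some; linarith)+
        have skipped: "\<not> matches (x + k) y" if "1 \<le> k" "k < h" for k
          using no_match_between[OF q(3) q(1) _ h(4)[OF that]] z that h(2)
          by (simp add: matches_def)
        \<comment> \<open>All shifts strictly between 0 and \<open>h\<close> are ruled out, so
          jumping to \<open>x + h\<close> misses no match.\<close>
        have set: "set r = set (reported s) \<union> {(x' + 1, y + 1) | x'. x' < x + h \<and> matches x' y}"
        proof -
          have "x' < Suc x \<longleftrightarrow> x' < x + h" if "matches x' y" for x'
          proof
            assume "x' < x + h"
            show "x' < Suc x"
            proof (rule ccontr)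
              assume "\<not> x' < Suc x"
              then have "1 \<le> x' - x" "x' - x < h" using \<open>x' < x + h\<close> by linarith+
              from skipped[OF this] \<open>\<not> x' < Suc x\<close> that show False by simp
            qed
          qed (use h(1) in simp)
          then show ?thesis unfolding r(2) by blast
        qed
        have match: "order_match (q - h * m) (window (x + h) y) p"
          using match_after_shift[OF q(3) q(1) _ h(3)] z h by simp
        have xhm: "(x + h) * m \<le> n * m" using xh by (intro mult_right_mono) auto
        then have le: "(x + h) * m + (q - h * m) \<le> n * m"
          using q(2) by (auto simp: add_mult_distrib)
        \<comment> \<open>The text pointer \<open>x * m + q\<close> never moves back; it jumps
          forward if the subtraction truncates.\<close>
        have d1: "n * m - ((x + h) * m + (q - h * m)) \<le> n * m - (x * m + q)"
          by (auto simp: add_mult_distrib intro!: diff_le_mono2)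
        have d2: "n - (x + h) + h = n - x" using xh by simp
        have pot: "(n * m - ((x + h) * m + (q - h * m)) + (n - (x + h))) * 2000 + h * 2000
          \<le> (n * m - (x * m + q) + (n - x)) * 2000"
        proof -
          have "(a + b) * 2000 + h * 2000 \<le> (a' + b') * 2000" if "a \<le> a'" "b + h = b'" for a a' b b' :: nat
            using that by auto
          then show "(n * m - ((x + h) * m + (q - h * m)) + (n - (x + h))) * 2000 + h * 2000
              \<le> (n * m - (x * m + q) + (n - x)) * 2000"
            using d1 d2 by blast
        qed
        have cost: "bcost (extends text_cell) \<le> 800"
          by (simp add: extends_def agrees_def Iff_def text_cell_def)
        define s3 where "s3 = s2\<lparr>regs := (regs s2)(''h'' := h, ''x'' := x + h, ''q'' := q - h * m)\<rparr>"
        have I3: "I s3"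
          using I q(1) xh le match set r(1) by (simp add: I_def ready_def linked_def s3_def s2_def)
        \<comment> \<open>As \<open>h \<ge> 1\<close>, \<open>2000 * h\<close> dominates
          \<open>20 * h + 20 + 900\<close>; the 900 cover the tests, above all
          \<open>extends text_cell\<close>.\<close>
        have \<mu>3: "t + 900 + \<mu> s3 \<le> \<mu> s'" if "t \<le> h * 20 + 20" for t
        proof -
          have "\<mu> s3 + h * 2000 \<le> \<mu> s'"
            using pot by (simp add: \<mu>_def s3_def x_def[symmetric] q_def[symmetric])
          with that h(1) show ?thesis by linarith
        qed
        show ?thesis
        proof (cases "q = m * m")
          case True
          then have "s2 = s'\<lparr>reported := (Suc x, Suc y) # reported s'\<rparr>"
            by (simp add: s2_def r_def)
          note h5 = h(5)[unfolded this] and I3 = I3[unfolded s3_def this] and \<mu>3 = \<mu>3[unfolded s3_def this]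
          show ?thesis
            using regs word word' xm True
            apply simp
            apply (rule run_mono[OF h5])
            using I3
            apply simp
            subgoal for t using \<mu>3[of t] cost by simp
            done
        next
          case neq: False
          with False have stop: "q < m * m" "\<not> order_match (Suc q) (window x y) p" using q by auto
          have "s2 = s'" using neq by (simp add: s2_def r_def)
          note h5 = h(5)[unfolded this] and I3 = I3[unfolded s3_def this] and \<mu>3 = \<mu>3[unfolded s3_def this]
          show ?thesis
            using regs word word' xm neq ext stop
            apply simp
            apply (rule run_mono[OF h5])
            using I3
            apply simp
            subgoal for t using \<mu>3[of t] cost by simp
            done
        qed
      qed
    qed
  qed
  have word: "word E 0 = Some 0" using bounds by (intro word_Some) linarith
  have final: "ready s' \<and> regs s' ''y'' = y \<and> distinct (reported s') \<and>
      set (reported s') = set (reported s) \<union> {(x + 1, y + 1) | x. matches x y}"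
    if "I s'" "bval E s' ?b = Some False" for s'
  proof -
    have "regs s' ''x'' + m \<le> n + m" using that(1) by (simp add: I_def)
    then have "word E (regs s' ''x'' + m) = Some (regs s' ''x'' + m)"
      using bounds by (intro word_Some) linarith
    then have "n < regs s' ''x'' + m" using that by (simp add: I_def ready_def)
    then have "x < regs s' ''x''" if "matches x y" for x
      using that by (simp add: matches_def)
    then have "{(x + 1, y + 1) | x. x < regs s' ''x'' \<and> matches x y} = {(x + 1, y + 1) | x. matches x y}"
      by blast
    then show ?thesis using that(1) by (simp add: I_def)
  qed
  from loop[OF I0] show ?thesis
    using word unfolding search_strip_def
    apply simp
    apply (erule run_mono)
    apply (simp add: final \<mu>_def)
    done
qed

lemma run_search:
  assumes "ready s" "reported s = []"
  shows "run E search s (\<lambda>t s'. t \<le> (n + 1) * ((n * m + n) * 2000 + 60) + 20 \<and>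
    distinct (reported s') \<and>
    set (reported s') = {(x + 1, y + 1) | x y. y + m \<le> n \<and> matches x y})"
proof -
  define I where "I s' \<longleftrightarrow> ready s' \<and> regs s' ''y'' + m \<le> n + 1 \<and> distinct (reported s') \<and>
    set (reported s') = {(x + 1, y + 1) | x y. y < regs s' ''y'' \<and> y + m \<le> n \<and> matches x y}" for s'
  have I0: "I (s\<lparr>regs := (regs s)(''y'' := 0)\<rparr>)"
    using assms m_le_n by (simp add: I_def ready_def linked_def)
  let ?b = "Not (Less (Var ''n'') (Op Add (Var ''y'') (Var ''m'')))"
  have b: "bval E s' ?b = Some (regs s' ''y'' + m \<le> n)" if "I s'" for s'
  proof -
    have "regs s' ''y'' + m \<le> n + 1" using that by (simp add: I_def)
    then have "word E (regs s' ''y'' + m) = Some (regs s' ''y'' + m)"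
      using bounds by (intro word_Some) linarith
    then show ?thesis using that by (auto simp: I_def ready_def)
  qed
  have loop: "run E (While ?b (search_strip ;; inc ''y'')) s1
    (\<lambda>t s'. I s' \<and> bval E s' ?b = Some False \<and>
      t \<le> (n + 1 - regs s1 ''y'') * ((n * m + n) * 2000 + 60) + 1 + bcost ?b)" if "I s1" for s1
  proof (rule run_While_count[where f = "\<lambda>s. n + 1 - regs s ''y''"], goal_cases)
    case 1
    show ?case by (fact that)
  next
    case (2 s')
    define y where "y = regs s' ''y''"
    show ?case
    proof (cases "y + m \<le> n")
      case False
      then show ?thesis unfolding b[OF 2] by (simp add: y_def)
    next
      case True
      have strip: "run E search_strip s' (\<lambda>t s''. t \<le> (n * m + n) * 2000 + 20 \<and> ready s'' \<and>
        regs s'' ''y'' = y \<and> distinct (reported s'') \<and>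
        set (reported s'') = set (reported s') \<union> {(x + 1, y + 1) | x. matches x y})"
        using 2 True by (intro run_search_strip) (auto simp: I_def y_def)
      have word: "word E 1 = Some 1" "word E (y + 1) = Some (y + 1)"
        using True bounds by (intro word_Some; linarith)+
      have set: "set (reported s') \<union> {(x + 1, y + 1) | x. matches x y} =
        {(x + 1, y' + 1) | x y'. y' < Suc y \<and> y' + m \<le> n \<and> matches x y'}"
        using 2 True by (auto simp: I_def y_def less_Suc_eq)
      have dec: "n - y < Suc n - y" using True by simp
      show ?thesis
        unfolding b[OF 2]
        apply simp
        apply (rule impI)
        apply (rule run_mono[OF strip])
        using word True dec set
        apply (simp add: I_def ready_def linked_def y_def[symmetric])
        done
    qed
  qed
  have word: "word E 0 = Some 0" using bounds by (intro word_Some) linarith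
  have final: "distinct (reported s') \<and>
      set (reported s') = {(x + 1, y + 1) | x y. y + m \<le> n \<and> matches x y}"
    if "I s'" "bval E s' ?b = Some False" for s'
  proof -
    have "\<not> regs s' ''y'' + m \<le> n" using b[OF that(1)] that(2) by (metis option.inject)
    then have "{(x + 1, y + 1) | x y. y < regs s' ''y'' \<and> y + m \<le> n \<and> matches x y} =
        {(x + 1, y + 1) | x y. y + m \<le> n \<and> matches x y}"
      by force
    then show ?thesis using that(1) by (simp add: I_def)
  qed
  from loop[OF I0] show ?thesis
    using word unfolding search_def
    apply simp
    apply (erule run_mono)
    apply (simp add: final)
    done
qed

section \<open>From linear matches to two-dimensional occurrences\<close>

lemma order_match_window_iff:
  "order_match (m * m) (window x y) p \<longleftrightarrow> order_isomorphic m m (substring2d T (x + 1) (y + 1)) P"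
proof
  assume A: "order_match (m * m) (window x y) p"
  show "order_isomorphic m m (substring2d T (x + 1) (y + 1)) P"
    unfolding order_isomorphic_def
  proof (intro ballI)
    fix ix iy jx jy assume "ix \<in> {1..m}" "iy \<in> {1..m}" "jx \<in> {1..m}" "jy \<in> {1..m}"
    then obtain a b c d where "ix = Suc a" "iy = Suc b" "jx = Suc c" "jy = Suc d"
      "a < m" "b < m" "c < m" "d < m"
      by (metis Suc_le_eq Suc_le_D One_nat_def atLeastAtMost_iff)
    \<comment> \<open>The cell in column \<open>a\<close> and row \<open>b\<close>, counted from 0,
      has linear index \<open>a * m + b\<close>.\<close>
    moreover from this have "a * m + b < m * m" "c * m + d < m * m"
      using index_less by auto
    ultimately show "substring2d T (x + 1) (y + 1) ix iy \<le> substring2d T (x + 1) (y + 1) jx jy \<longleftrightarrow>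
        P ix iy \<le> P jx jy"
      using A[unfolded order_match_def, rule_format, of "a * m + b" "c * m + d"]
      by (simp add: substring2d_def window_def p_def)
  qed
next
  assume A: "order_isomorphic m m (substring2d T (x + 1) (y + 1)) P"
  show "order_match (m * m) (window x y) p"
    unfolding order_match_def
  proof (intro allI impI)
    fix i j assume "i < m * m" "j < m * m"
    then have "i div m < m" "j div m < m" "i mod m < m" "j mod m < m"
      using m_pos by (auto simp: div_less_iff_less_mult)
    then show "window x y i \<le> window x y j \<longleftrightarrow> p i \<le> p j"
      using A[unfolded order_isomorphic_def, rule_format, of "i div m + 1" "i mod m + 1" "j div m + 1" "j mod m + 1"] m_pos
      by (simp add: substring2d_def window_def p_def Suc_le_eq)
  qed
qed

lemma occurrences_eq: "occurrences n m T P = {(x + 1, y + 1) | x y. y + m \<le> n \<and> matches x y}"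
proof (intro set_eqI)
  fix z :: "nat \<times> nat"
  obtain u v where z: "z = (u, v)" by (cases z)
  show "z \<in> occurrences n m T P \<longleftrightarrow> z \<in> {(x + 1, y + 1) | x y. y + m \<le> n \<and> matches x y}"
    by (cases u; cases v)
      (auto simp: z occurrences_def matches_def order_match_window_iff)
qed

lemma run_pattern_matching:
  "run E pattern_matching (initial_state n m) (\<lambda>t s'. t \<le> 20000 * (n * n * m) \<and>
    distinct (reported s') \<and> set (reported s') = occurrences n m T P)"
proof -
  let ?s = "initial_state n m"
  let ?s1 = "?s\<lparr>regs := (regs ?s)(''N'' := m * m)\<rparr>"
  have base: "base ?s1" by (simp add: base_def initial_state_def)
  have word: "word E (m * m) = Some (m * m)" using bounds by (intro word_Some) linarith
  \<comment> \<open>Each monomial is at most \<open>n * n * m\<close>, and all coefficients and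
    additive constants sum to less than 20000. The extra 20 pays for the initial test and for
    computing \<open>N\<close>.\<close>
  have cost: "t1 + (t2 + (t3 + t4)) + 20 \<le> 20000 * (n * n * m)"
    if "t1 \<le> m * m * (m * 200 + 100) + 10" "t2 \<le> m * m * (m * 400 + 100) + 10"
      "t3 \<le> m * (m * m * 1000 + 1500) + 10" "t4 \<le> (n + 1) * ((n * m + n) * 2000 + 60) + 20"
    for t1 t2 t3 t4
  proof -
    have "n * n \<le> n * n * m" using m_pos by simp
    moreover have "m * m * m \<le> n * n * m" using m_le_n by (intro mult_le_mono) auto
    ultimately have "m * m * m \<le> n * n * m" "m * m \<le> n * n * m" "m \<le> n * n * m" "n * n \<le> n * n * m"
      "n * m \<le> n * n * m" "n \<le> n * n * m" "1 \<le> n * n * m"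
      using bounds by linarith+
    moreover have "m * m * (m * 200 + 100) = 200 * (m * m * m) + 100 * (m * m)"
      "m * m * (m * 400 + 100) = 400 * (m * m * m) + 100 * (m * m)"
      "m * (m * m * 1000 + 1500) = 1000 * (m * m * m) + 1500 * m"
      "(n + 1) * ((n * m + n) * 2000 + 60) =
        2000 * (n * n * m) + 2000 * (n * n) + 60 * n + 2000 * (n * m) + 2000 * n + 60"
      by algebra+
    ultimately show ?thesis using that by linarith
  qed
  show ?thesis
    using bounds(1,2)
    apply (simp add: pattern_matching_def initial_state_def word)
    apply (rule run_mono[OF run_sort_columns])
     apply (simp add: base_def)
    apply (elim conjE)
    apply (rule run_mono[OF run_merge_columns], assumption+)
    apply (elim conjE)
    apply (rule run_mono[OF run_self_overlaps], assumption+)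
    apply (elim conjE)
    apply (rule run_mono[OF run_search])
      apply (simp add: ready_def base_def)
     apply (simp add: base_def)
    subgoal for t1 s1 t2 s2 t3 s3 t4 s4
      using cost[of t1 t2 t3 t4] occurrences_eq by simp
    done
qed

end

theorem theorem2:
  "\<exists>(prog :: com) (d :: nat) (C :: real). d \<ge> 1 \<and>
     (\<forall>(n :: nat) (m :: nat) (T :: string2d) (P :: string2d). n \<ge> 1 \<longrightarrow> m \<ge> 1 \<longrightarrow>
        (\<exists>t s. exec (machine d n m T P) prog (initial_state n m) t s \<and>
               distinct (reported s) \<and>
               set (reported s) = occurrences n m T P \<and>
               real t \<le> C * ((real n)\<^sup>2 * real m + (real m)\<^sup>2 * log 2 (real m))))"
proof (rule exI[of _ pattern_matching], rule exI[of _ 4], rule exI[of _ 20000],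
    rule conjI, simp, intro allI impI)
  fix n m :: nat and T P :: string2d
  assume n: "n \<ge> 1" and m: "m \<ge> 1"
  \<comment> \<open>Nonnegativity for \<open>m \<ge> 1\<close> allows adding the logarithmic summand
    to the bound \<open>n * n * m\<close>.\<close>
  have log: "0 \<le> (real m)\<^sup>2 * log 2 (real m)" using m by simp
  have "run (machine 4 n m T P) pattern_matching (initial_state n m) (\<lambda>t s. t \<le> 20000 * (n * n * m) \<and>
      distinct (reported s) \<and> set (reported s) = occurrences n m T P)"
  proof (cases "m \<le> n")
    case True
    then interpret matching n m T P using m by unfold_locales auto
    show ?thesis using run_pattern_matching by (simp add: E_def)
  next
    case False
    then have "occurrences n m T P = {}" by (auto simp: occurrences_def)
    \<comment> \<open>The early exit takes constant time, which the bound covers because the product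
      is at least 1.\<close>
    moreover have "1 * 1 * 1 \<le> n * n * m" using n m by (intro mult_le_mono)
    ultimately show ?thesis
      using False
      by (simp add: pattern_matching_def initial_state_def)
        (use \<open>1 * 1 * 1 \<le> n * n * m\<close> in linarith)
  qed
  then obtain t s where "exec (machine 4 n m T P) pattern_matching (initial_state n m) t s"
    and t: "t \<le> 20000 * (n * n * m)"
    and "distinct (reported s)" "set (reported s) = occurrences n m T P"
    by (auto simp: run_def)
  moreover have "real t \<le> 20000 * ((real n)\<^sup>2 * real m + (real m)\<^sup>2 * log 2 (real m))"
  proof -
    have "real t \<le> real (20000 * (n * n * m))" using t by (simp only: of_nat_le_iff)
    then show ?thesis using log by (simp add: power2_eq_square)
  qed
  ultimately show "\<exists>t s. exec (machine 4 n m T P) pattern_matching (initial_state n m) t s \<and>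
      distinct (reported s) \<and> set (reported s) = occurrences n m T P \<and>
      real t \<le> 20000 * ((real n)\<^sup>2 * real m + (real m)\<^sup>2 * log 2 (real m))"
    by blast
qed

end
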